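(* Let $H$ be a Hopf algebra with a bijective antipode, and assume that $(H\otimes H,\ \triangleright=m\otimes\mathrm{id},\ \rho^l=\rho_1\otimes\mathrm{id},\ \triangleleft=\mathrm{id}\otimes m,\ \rho^r=\mathrm{id}\otimes\rho_2)\in\mathcal{LR}(H)$, where $m$ is the usual multiplication of $H$ (so $h\triangleright(k\otimes l)=hk\otimes l$ and $(k\otimes l)\triangleleft h=k\otimes lh$), $\rho_1$ is a left coaction of $H$ on $H$ and $\rho_2$ is a right coaction of $H$ on $H$. Then $\psi_{H\otimes H,H\otimes H}$ is a symmetry (i.e. $\psi_{H\otimes H,H\otimes H}\circ\psi_{H\otimes H,H\otimes H}=\mathrm{id}$) if and only if there exists $R=R^1\otimes R^2\in H\otimes H$ so that $(H,R)$ is triangular. And then $\rho^l$ and $\rho^r$ are induced by $R$. That is, $$\rho^l(k\otimes l)=R^2\otimes R^1k\otimes l,\qquad \rho^r(k\otimes l)=k\otimes lR^1\otimes R^2,$$ for any $k,l\in H$; in particular, $R^{\tau}\otimes 1=\rho^l(1\otimes 1)$ and $1\otimes R=\rho^r(1\otimes 1)$, where $R^{\tau}=R^2\otimes R^1$.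
   Context: Everything is over a field $\Bbbk$; Sweedler notation $\Delta(h)=h_1\otimes h_2$ is used with summation omitted. A quasitriangular Hopf algebra is a pair $(H,R)$ with $H$ a Hopf algebra and $R=R^1\otimes R^2\in H\otimes H$ (summation omitted, $r=R$ a second copy) invertible such that $\Delta(R^1)\otimes R^2=R^1\otimes r^1\otimes R^2r^2$; $R^1\otimes\Delta(R^2)=R^1r^1\otimes r^2\otimes R^2$; $\Delta^{cop}(h)R=R\Delta(h)$ for all $h\in H$; $\varepsilon(R^1)R^2=1=R^1\varepsilon(R^2)$. It is triangular if moreover $R^{-1}=R^2\otimes R^1$. A Yetter-Drinfel'd-Long bimodule over $H$ is a vector space $M$ which is an $H$-bimodule (left action $h\otimes m\mapsto h\triangleright m$, right action $m\otimes h\mapsto m\triangleleft h$, with $(a\triangleright m)\triangleleft b=a\triangleright(m\triangleleft b)$) and an $H$-bicomodule (left coaction $\rho^l(m)=m_{[-1]}\otimes m_{[0]}\in H\otimes M$, right coaction $\rho^r(m)=m_{(0)}\otimes m_{(1)}\in M\otimes H$, with $m_{[-1]}\otimes m_{[0](0)}\otimes m_{[0](1)}=m_{(0)[-1]}\otimes m_{(0)[0]}\otimes m_{(1)}$), such that for all $h\in H$, $m\in M$: $(h_1\triangleright m)_{[-1]}h_2\otimes(h_1\triangleright m)_{[0]}=h_1m_{[-1]}\otimes h_2\triangleright m_{[0]}$; $(h\triangleright m)_{(0)}\otimes(h\triangleright m)_{(1)}=h\triangleright m_{(0)}\otimes m_{(1)}$; $(m\triangleleft h_2)_{(0)}\otimes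 h_1(m\triangleleft h_2)_{(1)}=m_{(0)}\triangleleft h_1\otimes m_{(1)}h_2$; $(m\triangleleft h)_{[-1]}\otimes(m\triangleleft h)_{[0]}=m_{[-1]}\otimes m_{[0]}\triangleleft h$. $\mathcal{LR}(H)$ is the category of Yetter-Drinfel'd-Long bimodules over $H$, with morphisms the $H$-bilinear and $H$-bicolinear maps. If the antipode of $H$ is bijective it is a braided monoidal category (diagonal actions and codiagonal coactions on tensor products) with braiding $\psi_{M,N}:M\otimes N\to N\otimes M$, $\psi_{M,N}(m\otimes n)=m_{[-1]}\triangleright n_{(0)}\otimes m_{[0]}\triangleleft n_{(1)}$.
   Formalization: A single R need not induce both coactions. Proved: ψ is a symmetry iff triangular R and S exist with ρ^l induced by R and ρ^r induced by S; the version with one R is proved when ρ_2(1) is the flip of ρ_1(1). Being induced is part of the equivalence. *)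

theory Defs
  imports Complex_Main "HOL-Library.Function_Algebras"
begin

section \<open>Vector spaces and their tensor products\<close>

text \<open>
  A vector space is a linear subspace of an ambient type. The ambient type is needed because
  \<open>V \<otimes> W\<close> depends on the scalar multiplications of \<open>V\<close> and \<open>W\<close>, so it
  cannot be a type of its own.
\<close>

record ('k, 'v) vspace =
  vcarrier :: "'v set"
  vscale :: "'k \<Rightarrow> 'v \<Rightarrow> 'v"

definition is_vspace :: "('k::field, 'v::ab_group_add, 'z) vspace_scheme \<Rightarrow> bool" where
  "is_vspace V \<longleftrightarrow> vector_space (vscale V) \<and> module.subspace (vscale V) (vcarrier V)"

definition scalars :: "('k::field, 'k) vspace" where
  "scalars = \<lparr>vcarrier = UNIV, vscale = (*)\<rparr>"

definition linmap ::
  "('k::field, 'v::ab_group_add, 'y) vspace_scheme \<Rightarrow> ('k, 'w::ab_group_add, 'z) vspace_scheme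
    \<Rightarrow> ('v \<Rightarrow> 'w) \<Rightarrow> bool" where
  "linmap V W f \<longleftrightarrow> (\<forall>x\<in>vcarrier V. f x \<in> vcarrier W)
     \<and> (\<forall>x\<in>vcarrier V. \<forall>y\<in>vcarrier V. f (x + y) = f x + f y)
     \<and> (\<forall>c. \<forall>x\<in>vcarrier V. f (vscale V c x) = vscale W c (f x))"

definition bilinear_form ::
  "('k::field, 'v::ab_group_add, 'y) vspace_scheme \<Rightarrow> ('k, 'w::ab_group_add, 'z) vspace_scheme
    \<Rightarrow> ('v \<Rightarrow> 'w \<Rightarrow> 'k) \<Rightarrow> bool" where
  "bilinear_form V W \<beta> \<longleftrightarrow> (\<forall>w. Vector_Spaces.linear (vscale V) (*) (\<lambda>v. \<beta> v w))
     \<and> (\<forall>v. Vector_Spaces.linear (vscale W) (*) (\<beta> v))"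

text \<open>
  The free vector space on pairs modulo the bilinearity relations is realised as a space of
  functionals on bilinear forms: \<open>v \<otimes> w\<close> is evaluation at \<open>(v, w)\<close>. Over a field
  this quotient embeds into its double dual, and the tensor product of subspaces embeds into the
  tensor product of the ambient spaces, so nothing is identified that should not be; lemma
  \<open>sweedler_sum_list\<close> below is the universal property.
\<close>

type_synonym ('k, 'v, 'w) tensor = "('v \<Rightarrow> 'w \<Rightarrow> 'k) \<Rightarrow> 'k"

definition tensor ::
  "'v::ab_group_add \<Rightarrow> ('k::field, 'v, 'y) vspace_scheme \<Rightarrow> ('k, 'w::ab_group_add, 'z) vspace_scheme
    \<Rightarrow> 'w \<Rightarrow> ('k, 'v, 'w) tensor"  (\<open>(_ \<otimes>\<^bsub>_,_\<^esub> _)\<close> [71, 0, 0, 70] 70) where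
  "(v \<otimes>\<^bsub>V,W\<^esub> w) = (\<lambda>\<beta>. if bilinear_form V W \<beta> then \<beta> v w else 0)"

definition tscale :: "'k::field \<Rightarrow> ('k, 'v, 'w) tensor \<Rightarrow> ('k, 'v, 'w) tensor" where
  "tscale c t = (\<lambda>\<beta>. c * t \<beta>)"

definition tensor_space ::
  "('k::field, 'v::ab_group_add, 'y) vspace_scheme \<Rightarrow> ('k, 'w::ab_group_add, 'z) vspace_scheme
    \<Rightarrow> ('k, ('k, 'v, 'w) tensor) vspace"  (infixr \<open>\<otimes>\<^sub>V\<close> 70) where
  "V \<otimes>\<^sub>V W = \<lparr>vcarrier = module.span tscale {v \<otimes>\<^bsub>V,W\<^esub> w | v w. v \<in> vcarrier V \<and> w \<in> vcarrier W},
     vscale = tscale\<rparr>"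

text \<open>
  Sweedler notation: \<open>sweedler V W t f\<close> is \<open>\<Sum>i. f (v i) (w i)\<close> for any way of writing
  \<open>t = \<Sum>i. v i \<otimes> w i\<close> in \<open>V \<otimes> W\<close>. By lemma \<open>sweedler_sum_list\<close> this does not depend
  on the representation when \<open>f\<close> is bilinear on \<open>V \<times> W\<close>, as it is in every use below.
\<close>

definition sweedler ::
  "('k::field, 'v::ab_group_add, 'y) vspace_scheme \<Rightarrow> ('k, 'w::ab_group_add, 'z) vspace_scheme
    \<Rightarrow> ('k, 'v, 'w) tensor \<Rightarrow> ('v \<Rightarrow> 'w \<Rightarrow> 'x::comm_monoid_add) \<Rightarrow> 'x" where
  "sweedler V W t f = (THE x. \<exists>ps. set ps \<subseteq> vcarrier V \<times> vcarrier W
      \<and> t = (\<Sum>(v, w)\<leftarrow>ps. v \<otimes>\<^bsub>V,W\<^esub> w) \<and> x = (\<Sum>(v, w)\<leftarrow>ps. f v w))"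

definition bilinear_on ::
  "('k::field, 'v::ab_group_add, 'y) vspace_scheme \<Rightarrow> ('k, 'w::ab_group_add, 'z) vspace_scheme
    \<Rightarrow> ('k, 'x::ab_group_add, 'u) vspace_scheme \<Rightarrow> ('v \<Rightarrow> 'w \<Rightarrow> 'x) \<Rightarrow> bool" where
  "bilinear_on V W X f \<longleftrightarrow> (\<forall>w\<in>vcarrier W. linmap V X (\<lambda>v. f v w))
     \<and> (\<forall>v\<in>vcarrier V. linmap W X (f v))"

lemma vector_space_tscale: "vector_space (tscale :: 'k::field \<Rightarrow> ('k, 'v, 'w) tensor \<Rightarrow> _)"
  by unfold_locales (auto simp: tscale_def fun_eq_iff algebra_simps)

lemma vector_space_times: "vector_space ((*) :: 'k::field \<Rightarrow> 'k \<Rightarrow> 'k)"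
  by unfold_locales (auto simp: algebra_simps)

lemma is_vspace_tensor_space: "is_vspace (V \<otimes>\<^sub>V W)"
proof -
  interpret vector_space "tscale :: 'k::field \<Rightarrow> ('k, 'v, 'w) tensor \<Rightarrow> _"
    by (rule vector_space_tscale)
  show ?thesis
    unfolding is_vspace_def tensor_space_def by (simp add: vector_space_axioms)
qed

lemma tensor_space_sum_list:
  assumes V: "is_vspace V" and t: "t \<in> vcarrier (V \<otimes>\<^sub>V W)"
  obtains ps where "set ps \<subseteq> vcarrier V \<times> vcarrier W" "t = (\<Sum>(v, w)\<leftarrow>ps. v \<otimes>\<^bsub>V,W\<^esub> w)"
proof -
  interpret vector_space tscale by (rule vector_space_tscale)
  interpret v: vector_space "vscale V" using V by (simp add: is_vspace_def)
  let ?P = "\<lambda>t. \<exists>ps. set ps \<subseteq> vcarrier V \<times> vcarrier W \<and> t = (\<Sum>(v, w)\<leftarrow>ps. v \<otimes>\<^bsub>V,W\<^esub> w)"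
  have scale: "tscale c (v \<otimes>\<^bsub>V,W\<^esub> w) = (vscale V c v \<otimes>\<^bsub>V,W\<^esub> w)" for c v w
    by (auto simp: tscale_def tensor_def fun_eq_iff bilinear_form_def Vector_Spaces.linear_iff)
  have "?P t"
    using t[unfolded tensor_space_def, simplified]
  proof (induction rule: span_induct_alt)
    case base
    show ?case by (rule exI[of _ "[]"]) simp
  next
    case (step c x y)
    then obtain v w ps where *: "v \<in> vcarrier V" "w \<in> vcarrier W" "x = (v \<otimes>\<^bsub>V,W\<^esub> w)"
      "set ps \<subseteq> vcarrier V \<times> vcarrier W" "y = (\<Sum>(v, w)\<leftarrow>ps. v \<otimes>\<^bsub>V,W\<^esub> w)" by blast
    have "vscale V c v \<in> vcarrier V"
      using V *(1) by (simp add: is_vspace_def v.subspace_scale)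
    with * show ?case
      by (intro exI[of _ "(vscale V c v, w) # ps"]) (auto simp: scale)
  qed
  with that show ?thesis by blast
qed

lemma exists_projection:
  assumes "is_vspace V"
  obtains p where "Vector_Spaces.linear (vscale V) (vscale V) p" "\<And>v. p v \<in> vcarrier V"
    "\<And>v. v \<in> vcarrier V \<Longrightarrow> p v = v"
proof -
  interpret vector_space "vscale V" using assms by (simp add: is_vspace_def)
  interpret vector_space_pair "vscale V" "vscale V" ..
  have "\<exists>g. g ` UNIV \<subseteq> vcarrier V \<and> Vector_Spaces.linear (vscale V) (vscale V) g
      \<and> (\<forall>v\<in>vcarrier V. g (id v) = v)"
    using assms by (intro linear_exists_left_inverse_on)
      (auto simp: is_vspace_def Vector_Spaces.linear_iff)
  then show ?thesis using that by (auto simp: image_subset_iff)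
qed

lemma exists_functional:
  assumes "vector_space s" "x \<noteq> 0"
  obtains f where "Vector_Spaces.linear s (*) f" "f x \<noteq> (0::'k::field)"
proof -
  interpret vector_space s by fact
  interpret k: vector_space "(*) :: 'k \<Rightarrow> _" by (rule vector_space_times)
  interpret vector_space_pair s "(*) :: 'k \<Rightarrow> _" ..
  have "independent {x}" using assms(2) by simp
  from linear_independent_extend[OF this, of "\<lambda>_. 1"] show ?thesis
    using that by force
qed

lemma sum_list_rep_unique:
  fixes X :: "('k::field, 'x::ab_group_add, 'u) vspace_scheme"
  assumes V: "is_vspace V" and W: "is_vspace W" and X: "is_vspace X" and f: "bilinear_on V W X f"
    and ps: "set ps \<subseteq> vcarrier V \<times> vcarrier W" and qs: "set qs \<subseteq> vcarrier V \<times> vcarrier W"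
    and eq: "(\<Sum>(v, w)\<leftarrow>ps. v \<otimes>\<^bsub>V,W\<^esub> w) = (\<Sum>(v, w)\<leftarrow>qs. v \<otimes>\<^bsub>V,W\<^esub> w)"
  shows "(\<Sum>(v, w)\<leftarrow>ps. f v w) = (\<Sum>(v, w)\<leftarrow>qs. f v w)"
proof (rule ccontr)
  assume ne: "\<not> ?thesis"
  obtain p where p: "Vector_Spaces.linear (vscale V) (vscale V) p" "\<And>v. p v \<in> vcarrier V"
    "\<And>v. v \<in> vcarrier V \<Longrightarrow> p v = v" using exists_projection[OF V] by blast
  obtain q where q: "Vector_Spaces.linear (vscale W) (vscale W) q" "\<And>v. q v \<in> vcarrier W"
    "\<And>v. v \<in> vcarrier W \<Longrightarrow> q v = v" using exists_projection[OF W] by blast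
  have "(\<Sum>(v, w)\<leftarrow>ps. f v w) - (\<Sum>(v, w)\<leftarrow>qs. f v w) \<noteq> 0"
    using ne by simp
  then obtain g where g: "Vector_Spaces.linear (vscale X) (*) g"
    "g ((\<Sum>(v, w)\<leftarrow>ps. f v w) - (\<Sum>(v, w)\<leftarrow>qs. f v w)) \<noteq> (0::'k)"
    by (rule exists_functional[OF X[unfolded is_vspace_def, THEN conjunct1]])
  interpret g: Vector_Spaces.linear "vscale X" "(*)" g by (rule g(1))
  define \<beta> where "\<beta> v w = g (f (p v) (q w))" for v w
  have lin: "Vector_Spaces.linear (vscale V) (*) (\<lambda>v. \<beta> v w)"
    "Vector_Spaces.linear (vscale W) (*) (\<beta> v)" for v w
    using f p q V W vector_space_times[where 'k='k]
    by (simp_all add: Vector_Spaces.linear_iff is_vspace_def bilinear_on_def linmap_def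
        \<beta>_def g.add g.scale)
  then have \<beta>: "bilinear_form V W \<beta>"
    unfolding bilinear_form_def by blast
  have tensor_\<beta>: "(v \<otimes>\<^bsub>V,W\<^esub> w) \<beta> = g (f v w)" if "v \<in> vcarrier V" "w \<in> vcarrier W" for v w
    unfolding tensor_def if_P[OF \<beta>] by (simp add: \<beta>_def p(3) q(3) that)
  have g_sum: "g (\<Sum>(v, w)\<leftarrow>rs. f v w) = (\<Sum>(v, w)\<leftarrow>rs. v \<otimes>\<^bsub>V,W\<^esub> w) \<beta>"
    if "set rs \<subseteq> vcarrier V \<times> vcarrier W" for rs
    using that
  proof (induction rs)
    case Nil
    then show ?case by (simp add: g.zero)
  next
    case (Cons r rs)
    then show ?case
      by (cases r) (simp add: g.add tensor_\<beta>)
  qed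
  have "g ((\<Sum>(v, w)\<leftarrow>ps. f v w) - (\<Sum>(v, w)\<leftarrow>qs. f v w)) = 0"
    unfolding g.diff g_sum[OF ps] g_sum[OF qs] eq by simp
  with g(2) show False by contradiction
qed

lemma sweedler_sum_list:
  fixes X :: "('k::field, 'x::ab_group_add, 'u) vspace_scheme"
  assumes "is_vspace V" "is_vspace W" "is_vspace X" "bilinear_on V W X f"
    and "set ps \<subseteq> vcarrier V \<times> vcarrier W"
  shows "sweedler V W (\<Sum>(v, w)\<leftarrow>ps. v \<otimes>\<^bsub>V,W\<^esub> w) f = (\<Sum>(v, w)\<leftarrow>ps. f v w)"
  unfolding sweedler_def
proof (rule the_equality)
  show "\<exists>qs. set qs \<subseteq> vcarrier V \<times> vcarrier W
      \<and> (\<Sum>(v, w)\<leftarrow>ps. v \<otimes>\<^bsub>V,W\<^esub> w) = (\<Sum>(v, w)\<leftarrow>qs. v \<otimes>\<^bsub>V,W\<^esub> w)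
      \<and> (\<Sum>(v, w)\<leftarrow>ps. f v w) = (\<Sum>(v, w)\<leftarrow>qs. f v w)"
    using assms(5) by blast
next
  fix x
  assume "\<exists>qs. set qs \<subseteq> vcarrier V \<times> vcarrier W
      \<and> (\<Sum>(v, w)\<leftarrow>ps. v \<otimes>\<^bsub>V,W\<^esub> w) = (\<Sum>(v, w)\<leftarrow>qs. v \<otimes>\<^bsub>V,W\<^esub> w)
      \<and> x = (\<Sum>(v, w)\<leftarrow>qs. f v w)"
  then obtain qs where qs: "set qs \<subseteq> vcarrier V \<times> vcarrier W"
      "(\<Sum>(v, w)\<leftarrow>ps. v \<otimes>\<^bsub>V,W\<^esub> w) = (\<Sum>(v, w)\<leftarrow>qs. v \<otimes>\<^bsub>V,W\<^esub> w)"
      "x = (\<Sum>(v, w)\<leftarrow>qs. f v w)"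
    by (elim exE conjE)
  show "x = (\<Sum>(v, w)\<leftarrow>ps. f v w)"
    unfolding qs(3) by (rule sum_list_rep_unique[OF assms(1-5) qs(1,2), symmetric])
qed


section \<open>Hopf algebras and (quasi)triangular structures\<close>

text \<open>
  The multiplication and unit of \<open>H\<close> are those of the class \<^class>\<open>ring_1\<close>. Its axiom
  \<open>0 \<noteq> 1\<close> is no restriction, since \<open>\<epsilon>(1) = 1\<close>. Iterated tensor products associate to the
  right: \<open>x \<otimes> y \<otimes> z\<close> is \<open>x \<otimes> (y \<otimes> z)\<close>.
\<close>

record ('k, 'h) hopf = "('k, 'h) vspace" +
  comult :: "'h \<Rightarrow> ('k, 'h, 'h) tensor"
  counit :: "'h \<Rightarrow> 'k"
  antipode :: "'h \<Rightarrow> 'h"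

definition tmult ::
  "('k::field, 'h::ring_1, 'z) hopf_scheme
    \<Rightarrow> ('k, 'h, 'h) tensor \<Rightarrow> ('k, 'h, 'h) tensor \<Rightarrow> ('k, 'h, 'h) tensor" where
  "tmult H s t = sweedler H H s (\<lambda>a b. sweedler H H t (\<lambda>c d. (a * c) \<otimes>\<^bsub>H,H\<^esub> (b * d)))"

definition tflip ::
  "('k::field, 'h::ring_1, 'z) hopf_scheme \<Rightarrow> ('k, 'h, 'h) tensor \<Rightarrow> ('k, 'h, 'h) tensor" where
  "tflip H t = sweedler H H t (\<lambda>a b. b \<otimes>\<^bsub>H,H\<^esub> a)"

locale hopf_algebra =
  fixes H :: "('k::field, 'h::ring_1, 'z) hopf_scheme"
  assumes carrier: "vcarrier H = UNIV"
    and vector_space: "vector_space (vscale H)"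
    and scale_mult_left: "vscale H c a * b = vscale H c (a * b)"
    and scale_mult_right: "a * vscale H c b = vscale H c (a * b)"
    and comult_linear: "linmap H (H \<otimes>\<^sub>V H) (comult H)"
    and counit_linear: "linmap H scalars (counit H)"
    and coassoc:
      "sweedler H H (comult H h) (\<lambda>h1 h2. sweedler H H (comult H h1)
         (\<lambda>a b. a \<otimes>\<^bsub>H,H \<otimes>\<^sub>V H\<^esub> (b \<otimes>\<^bsub>H,H\<^esub> h2)))
       = sweedler H H (comult H h) (\<lambda>h1 h2. h1 \<otimes>\<^bsub>H,H \<otimes>\<^sub>V H\<^esub> comult H h2)"
    and counit_left: "sweedler H H (comult H h) (\<lambda>h1 h2. vscale H (counit H h1) h2) = h"
    and counit_right: "sweedler H H (comult H h) (\<lambda>h1 h2. vscale H (counit H h2) h1) = h"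
    and comult_mult: "comult H (g * h) = tmult H (comult H g) (comult H h)"
    and comult_one: "comult H 1 = (1 \<otimes>\<^bsub>H,H\<^esub> 1)"
    and counit_mult: "counit H (g * h) = counit H g * counit H h"
    and counit_one: "counit H 1 = 1"
    and antipode_linear: "linmap H H (antipode H)"
    and antipode_left: "sweedler H H (comult H h) (\<lambda>h1 h2. antipode H h1 * h2) = vscale H (counit H h) 1"
    and antipode_right: "sweedler H H (comult H h) (\<lambda>h1 h2. h1 * antipode H h2) = vscale H (counit H h) 1"

definition is_tinverse ::
  "('k::field, 'h::ring_1, 'z) hopf_scheme \<Rightarrow> ('k, 'h, 'h) tensor \<Rightarrow> ('k, 'h, 'h) tensor \<Rightarrow> bool" where
  "is_tinverse H R Q \<longleftrightarrow> Q \<in> vcarrier (H \<otimes>\<^sub>V H)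
     \<and> tmult H R Q = (1 \<otimes>\<^bsub>H,H\<^esub> 1) \<and> tmult H Q R = (1 \<otimes>\<^bsub>H,H\<^esub> 1)"

definition quasitriangular ::
  "('k::field, 'h::ring_1, 'z) hopf_scheme \<Rightarrow> ('k, 'h, 'h) tensor \<Rightarrow> bool" where
  "quasitriangular H R \<longleftrightarrow> hopf_algebra H \<and> R \<in> vcarrier (H \<otimes>\<^sub>V H) \<and> (\<exists>Q. is_tinverse H R Q)
     \<and> sweedler H H R (\<lambda>R1 R2. sweedler H H (comult H R1) (\<lambda>a b. a \<otimes>\<^bsub>H,H \<otimes>\<^sub>V H\<^esub> (b \<otimes>\<^bsub>H,H\<^esub> R2)))
       = sweedler H H R (\<lambda>R1 R2. sweedler H H R (\<lambda>r1 r2. R1 \<otimes>\<^bsub>H,H \<otimes>\<^sub>V H\<^esub> (r1 \<otimes>\<^bsub>H,H\<^esub> (R2 * r2))))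
     \<and> sweedler H H R (\<lambda>R1 R2. R1 \<otimes>\<^bsub>H,H \<otimes>\<^sub>V H\<^esub> comult H R2)
       = sweedler H H R (\<lambda>R1 R2. sweedler H H R (\<lambda>r1 r2. (R1 * r1) \<otimes>\<^bsub>H,H \<otimes>\<^sub>V H\<^esub> (r2 \<otimes>\<^bsub>H,H\<^esub> R2)))
     \<and> (\<forall>h. tmult H (tflip H (comult H h)) R = tmult H R (comult H h))
     \<and> sweedler H H R (\<lambda>R1 R2. vscale H (counit H R1) R2) = 1
     \<and> sweedler H H R (\<lambda>R1 R2. vscale H (counit H R2) R1) = 1"

definition triangular ::
  "('k::field, 'h::ring_1, 'z) hopf_scheme \<Rightarrow> ('k, 'h, 'h) tensor \<Rightarrow> bool" where
  "triangular H R \<longleftrightarrow> quasitriangular H R \<and> is_tinverse H R (tflip H R)"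


section \<open>Yetter-Drinfel'd-Long bimodules\<close>

definition left_comodule ::
  "('k::field, 'h::ring_1, 'z) hopf_scheme \<Rightarrow> ('k, 'm::ab_group_add, 'y) vspace_scheme
    \<Rightarrow> ('m \<Rightarrow> ('k, 'h, 'm) tensor) \<Rightarrow> bool" where
  "left_comodule H M \<rho> \<longleftrightarrow> linmap M (H \<otimes>\<^sub>V M) \<rho>
     \<and> (\<forall>m\<in>vcarrier M.
          sweedler H M (\<rho> m) (\<lambda>a n. sweedler H H (comult H a)
            (\<lambda>a1 a2. a1 \<otimes>\<^bsub>H,H \<otimes>\<^sub>V M\<^esub> (a2 \<otimes>\<^bsub>H,M\<^esub> n)))
          = sweedler H M (\<rho> m) (\<lambda>a n. a \<otimes>\<^bsub>H,H \<otimes>\<^sub>V M\<^esub> \<rho> n))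
     \<and> (\<forall>m\<in>vcarrier M. sweedler H M (\<rho> m) (\<lambda>a n. vscale M (counit H a) n) = m)"

definition right_comodule ::
  "('k::field, 'h::ring_1, 'z) hopf_scheme \<Rightarrow> ('k, 'm::ab_group_add, 'y) vspace_scheme
    \<Rightarrow> ('m \<Rightarrow> ('k, 'm, 'h) tensor) \<Rightarrow> bool" where
  "right_comodule H M \<rho> \<longleftrightarrow> linmap M (M \<otimes>\<^sub>V H) \<rho>
     \<and> (\<forall>m\<in>vcarrier M.
          sweedler M H (\<rho> m) (\<lambda>n a. sweedler M H (\<rho> n)
            (\<lambda>n' b. n' \<otimes>\<^bsub>M,H \<otimes>\<^sub>V H\<^esub> (b \<otimes>\<^bsub>H,H\<^esub> a)))
          = sweedler M H (\<rho> m) (\<lambda>n a. n \<otimes>\<^bsub>M,H \<otimes>\<^sub>V H\<^esub> comult H a))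
     \<and> (\<forall>m\<in>vcarrier M. sweedler M H (\<rho> m) (\<lambda>n a. vscale M (counit H a) n) = m)"

definition left_module ::
  "('k::field, 'h::ring_1, 'z) hopf_scheme \<Rightarrow> ('k, 'm::ab_group_add, 'y) vspace_scheme
    \<Rightarrow> ('h \<Rightarrow> 'm \<Rightarrow> 'm) \<Rightarrow> bool" where
  "left_module H M act \<longleftrightarrow> bilinear_on H M M act
     \<and> (\<forall>m\<in>vcarrier M. act 1 m = m \<and> (\<forall>a b. act (a * b) m = act a (act b m)))"

definition right_module ::
  "('k::field, 'h::ring_1, 'z) hopf_scheme \<Rightarrow> ('k, 'm::ab_group_add, 'y) vspace_scheme
    \<Rightarrow> ('m \<Rightarrow> 'h \<Rightarrow> 'm) \<Rightarrow> bool" where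
  "right_module H M act \<longleftrightarrow> bilinear_on M H M act
     \<and> (\<forall>m\<in>vcarrier M. act m 1 = m \<and> (\<forall>a b. act m (a * b) = act (act m a) b))"

record ('k, 'h, 'm) ydl = "('k, 'm) vspace" +
  lact :: "'h \<Rightarrow> 'm \<Rightarrow> 'm"
  ract :: "'m \<Rightarrow> 'h \<Rightarrow> 'm"
  lcoact :: "'m \<Rightarrow> ('k, 'h, 'm) tensor"
  rcoact :: "'m \<Rightarrow> ('k, 'm, 'h) tensor"

text \<open>The objects of the category \<open>\<L>\<R>(H)\<close>.\<close>

locale yetter_drinfeld_long = hopf_algebra H
  for H :: "('k::field, 'h::ring_1, 'z) hopf_scheme" +
  fixes M :: "('k, 'h, 'm::ab_group_add, 'y) ydl_scheme"
  assumes is_vspace: "is_vspace M"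
    and left_module: "left_module H M (lact M)"
    and right_module: "right_module H M (ract M)"
    and left_comodule: "left_comodule H M (lcoact M)"
    and right_comodule: "right_comodule H M (rcoact M)"
    and bimodule: "m \<in> vcarrier M \<Longrightarrow> ract M (lact M a m) b = lact M a (ract M m b)"
    and bicomodule: "m \<in> vcarrier M \<Longrightarrow>
      sweedler H M (lcoact M m) (\<lambda>a n. a \<otimes>\<^bsub>H,M \<otimes>\<^sub>V H\<^esub> rcoact M n)
      = sweedler M H (rcoact M m) (\<lambda>n b. sweedler H M (lcoact M n)
          (\<lambda>a n'. a \<otimes>\<^bsub>H,M \<otimes>\<^sub>V H\<^esub> (n' \<otimes>\<^bsub>M,H\<^esub> b)))"
    and lact_lcoact: "m \<in> vcarrier M \<Longrightarrow>
      sweedler H H (comult H h) (\<lambda>h1 h2. sweedler H M (lcoact M (lact M h1 m))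
        (\<lambda>a n. (a * h2) \<otimes>\<^bsub>H,M\<^esub> n))
      = sweedler H H (comult H h) (\<lambda>h1 h2. sweedler H M (lcoact M m)
        (\<lambda>a n. (h1 * a) \<otimes>\<^bsub>H,M\<^esub> lact M h2 n))"
    and lact_rcoact: "m \<in> vcarrier M \<Longrightarrow>
      rcoact M (lact M h m) = sweedler M H (rcoact M m) (\<lambda>n b. lact M h n \<otimes>\<^bsub>M,H\<^esub> b)"
    and ract_rcoact: "m \<in> vcarrier M \<Longrightarrow>
      sweedler H H (comult H h) (\<lambda>h1 h2. sweedler M H (rcoact M (ract M m h2))
        (\<lambda>n b. n \<otimes>\<^bsub>M,H\<^esub> (h1 * b)))
      = sweedler H H (comult H h) (\<lambda>h1 h2. sweedler M H (rcoact M m)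
        (\<lambda>n b. ract M n h1 \<otimes>\<^bsub>M,H\<^esub> (b * h2)))"
    and ract_lcoact: "m \<in> vcarrier M \<Longrightarrow>
      lcoact M (ract M m h) = sweedler H M (lcoact M m) (\<lambda>a n. a \<otimes>\<^bsub>H,M\<^esub> ract M n h)"

definition braiding ::
  "('k::field, 'h::ring_1, 'z) hopf_scheme \<Rightarrow> ('k, 'h, 'm::ab_group_add, 'x) ydl_scheme
    \<Rightarrow> ('k, 'h, 'n::ab_group_add, 'y) ydl_scheme \<Rightarrow> ('k, 'm, 'n) tensor \<Rightarrow> ('k, 'n, 'm) tensor" where
  "braiding H M N t = sweedler M N t (\<lambda>m n.
     sweedler H M (lcoact M m) (\<lambda>a m0. sweedler N H (rcoact N n) (\<lambda>n0 b.
       lact N a n0 \<otimes>\<^bsub>N,M\<^esub> ract M m0 b)))"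

text \<open>\<open>H \<otimes> H\<close> with \<open>\<triangleright> = m \<otimes> id\<close>, \<open>\<triangleleft> = id \<otimes> m\<close>,
  \<open>\<rho>\<^sup>l = \<rho>1 \<otimes> id\<close> and \<open>\<rho>\<^sup>r = id \<otimes> \<rho>2\<close>.\<close>

definition tensor_square ::
  "('k::field, 'h::ring_1, 'z) hopf_scheme \<Rightarrow> ('h \<Rightarrow> ('k, 'h, 'h) tensor)
    \<Rightarrow> ('h \<Rightarrow> ('k, 'h, 'h) tensor) \<Rightarrow> ('k, 'h, ('k, 'h, 'h) tensor) ydl" where
  "tensor_square H \<rho>1 \<rho>2 =
    \<lparr>vcarrier = vcarrier (H \<otimes>\<^sub>V H),
     vscale = vscale (H \<otimes>\<^sub>V H),
     lact = (\<lambda>h t. sweedler H H t (\<lambda>k l. (h * k) \<otimes>\<^bsub>H,H\<^esub> l)),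
     ract = (\<lambda>t h. sweedler H H t (\<lambda>k l. k \<otimes>\<^bsub>H,H\<^esub> (l * h))),
     lcoact = (\<lambda>t. sweedler H H t (\<lambda>k l. sweedler H H (\<rho>1 k)
       (\<lambda>a k0. a \<otimes>\<^bsub>H,H \<otimes>\<^sub>V H\<^esub> (k0 \<otimes>\<^bsub>H,H\<^esub> l)))),
     rcoact = (\<lambda>t. sweedler H H t (\<lambda>k l. sweedler H H (\<rho>2 l)
       (\<lambda>l0 b. (k \<otimes>\<^bsub>H,H\<^esub> l0) \<otimes>\<^bsub>H \<otimes>\<^sub>V H,H\<^esub> b)))\<rparr>"

definition left_induced ::
  "('k::field, 'h::ring_1, 'z) hopf_scheme \<Rightarrow> ('k, 'h, 'h) tensor
    \<Rightarrow> (('k, 'h, 'h) tensor \<Rightarrow> ('k, 'h, ('k, 'h, 'h) tensor) tensor) \<Rightarrow> bool" where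
  "left_induced H R \<rho>l \<longleftrightarrow> (\<forall>k l. \<rho>l (k \<otimes>\<^bsub>H,H\<^esub> l)
     = sweedler H H R (\<lambda>R1 R2. R2 \<otimes>\<^bsub>H,H \<otimes>\<^sub>V H\<^esub> ((R1 * k) \<otimes>\<^bsub>H,H\<^esub> l)))"

definition right_induced ::
  "('k::field, 'h::ring_1, 'z) hopf_scheme \<Rightarrow> ('k, 'h, 'h) tensor
    \<Rightarrow> (('k, 'h, 'h) tensor \<Rightarrow> ('k, ('k, 'h, 'h) tensor, 'h) tensor) \<Rightarrow> bool" where
  "right_induced H R \<rho>r \<longleftrightarrow> (\<forall>k l. \<rho>r (k \<otimes>\<^bsub>H,H\<^esub> l)
     = sweedler H H R (\<lambda>R1 R2. (k \<otimes>\<^bsub>H,H\<^esub> (l * R1)) \<otimes>\<^bsub>H \<otimes>\<^sub>V H,H\<^esub> R2))"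

end

theory Submission
  imports Defs
begin

text \<open>
  Write \<open>M\<close> for \<open>H \<otimes> H\<close> with the given structure, \<open>\<rho>1 k = k\<^sub>-\<^sub>1 \<otimes> k\<^sub>0\<close> and
  \<open>\<rho>2 l = l\<^sub>0 \<otimes> l\<^sub>1\<close>. The braiding
  sends \<open>(k \<otimes> l) \<otimes> (k' \<otimes> l')\<close> to \<open>(k\<^sub>-\<^sub>1 k' \<otimes> l'\<^sub>0) \<otimes> (k\<^sub>0 \<otimes> l l'\<^sub>1)\<close>,
  so it acts independently on the pairs \<open>(k, k')\<close> and \<open>(l, l')\<close>. Applying \<open>\<epsilon> \<otimes> \<epsilon>\<close> to one
  pair shows that the square of the braiding is the identity only if both factors
  \<open>k \<otimes> k' \<mapsto> k\<^sub>-\<^sub>1 k' \<otimes> k\<^sub>0\<close> and \<open>l \<otimes> l' \<mapsto> l'\<^sub>0 \<otimes> l l'\<^sub>1\<close> are involutions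
  (\<open>involution_\<rho>1\<close>, \<open>involution_\<rho>2\<close>).

  Let \<open>Q = \<rho>1 1\<close>. The first factor \<open>\<psi>\<close> turns right multiplication of its second argument into
  right multiplication of the first tensor leg. Being its own inverse it also turns right multiplication
  of its first argument into right multiplication of the second leg, which gives
  \<open>\<rho>1 k = Q (1 \<otimes> k)\<close>. Now every condition on \<open>\<rho>1\<close> becomes a condition on \<open>Q\<close>: the
  Yetter-Drinfel'd condition is \<open>Q \<Delta>\<^sup>c\<^sup>o\<^sup>p(h) = \<Delta>(h) Q\<close>, the equation \<open>\<psi> \<psi> = id\<close> is
  \<open>Q Q\<^sub>2\<^sub>1 = 1\<close>, coassociativity is \<open>(\<Delta> \<otimes> id) Q = Q\<^sub>2\<^sub>3 Q\<^sub>1\<^sub>3\<close>, and the other hexagon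
  equation \<open>(id \<otimes> \<Delta>) Q = Q\<^sub>1\<^sub>2 Q\<^sub>1\<^sub>3\<close> follows by taking inverses, since \<open>Q\<^sub>2\<^sub>1\<close> is the inverse of
  \<open>Q\<close> (\<open>comult_right_factor\<close>, \<open>triangular_form_of_involution\<close>). Hence \<open>R = Q\<^sub>2\<^sub>1\<close> is a
  triangular structure inducing the left coaction. The argument for \<open>\<rho>2\<close> is the same one for
  the bialgebra with opposite multiplication and opposite comultiplication, so the core is proved for
  an abstract multiplication and comultiplication and used twice; the notion of a triangular structure is
  invariant under passing to this opposite (\<open>triangular_form_left_of_right\<close>).

  Conversely, if triangular \<open>R\<close> and \<open>S\<close> induce the two coactions, the square of the braiding
  multiplies the pairs by \<open>R\<^sub>2\<^sub>1 R = 1\<close> and \<open>S\<^sub>2\<^sub>1 S = 1\<close> (\<open>symmetry_of_triangular\<close>).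

  Elements of \<open>H \<otimes> H\<close> are handled as the functionals on bilinear forms which they are by
  definition. Sweedler notation with scalar values is then function application: \<open>t (\<lambda>a b. f a b)\<close>
  is \<open>f(t\<^sup>1, t\<^sup>2)\<close>, Fubini's rule is \<open>eval_swap\<close>, and an identity between tensors is proved
  by evaluating both sides on all forms.
\<close>

section \<open>Linear maps out of tensor products\<close>

lemma is_vspaceD:
  assumes "is_vspace V"
  shows "x \<in> vcarrier V \<Longrightarrow> y \<in> vcarrier V \<Longrightarrow> x + y \<in> vcarrier V"
    and "0 \<in> vcarrier V"
    and "x \<in> vcarrier V \<Longrightarrow> vscale V c x \<in> vcarrier V"
    and "vscale V c (a + b) = vscale V c a + vscale V c b"
    and "vscale V c 0 = 0"
proof -
  interpret vector_space "vscale V" using assms by (simp add: is_vspace_def)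
  have S: "module.subspace (vscale V) (vcarrier V)" using assms by (simp add: is_vspace_def)
  show "x \<in> vcarrier V \<Longrightarrow> y \<in> vcarrier V \<Longrightarrow> x + y \<in> vcarrier V"
    "0 \<in> vcarrier V" "x \<in> vcarrier V \<Longrightarrow> vscale V c x \<in> vcarrier V"
    using S by (auto intro: subspace_add subspace_0 subspace_scale)
  show "vscale V c (a + b) = vscale V c a + vscale V c b" "vscale V c 0 = 0"
    by (simp_all add: scale_right_distrib)
qed

lemma is_vspace_scalars: "is_vspace (scalars :: ('k::field, 'k) vspace)"
proof -
  interpret vector_space "(*) :: 'k \<Rightarrow> 'k \<Rightarrow> 'k" by (rule vector_space_times)
  show ?thesis by (simp add: is_vspace_def scalars_def vector_space_axioms)
qed

lemma scalars_simps [simp]: "vcarrier scalars = UNIV" "vscale scalars = (*)"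
  by (simp_all add: scalars_def)

lemma vscale_tensor_space [simp]: "vscale (V \<otimes>\<^sub>V W) = tscale"
  by (simp add: tensor_space_def)

lemma linmapD:
  assumes "linmap V W f"
  shows "x \<in> vcarrier V \<Longrightarrow> f x \<in> vcarrier W"
    and "x \<in> vcarrier V \<Longrightarrow> y \<in> vcarrier V \<Longrightarrow> f (x + y) = f x + f y"
    and "x \<in> vcarrier V \<Longrightarrow> f (vscale V c x) = vscale W c (f x)"
  using assms by (auto simp: linmap_def)

lemma linmap_zero:
  assumes "linmap V W f" "is_vspace V"
  shows "f 0 = 0"
  using linmapD(2)[OF assms(1), of 0 0] is_vspaceD(2)[OF assms(2)] by simp

lemma linmap_sum_list:
  assumes f: "linmap V W f" and V: "is_vspace V" and "\<And>p. p \<in> set ps \<Longrightarrow> g p \<in> vcarrier V"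
  shows "(\<Sum>p\<leftarrow>ps. g p) \<in> vcarrier V" "f (\<Sum>p\<leftarrow>ps. g p) = (\<Sum>p\<leftarrow>ps. f (g p))"
proof -
  have "(\<Sum>p\<leftarrow>ps. g p) \<in> vcarrier V \<and> f (\<Sum>p\<leftarrow>ps. g p) = (\<Sum>p\<leftarrow>ps. f (g p))"
    using assms(3) by (induction ps) (auto simp: is_vspaceD[OF V] linmapD[OF f] linmap_zero[OF f V])
  then show "(\<Sum>p\<leftarrow>ps. g p) \<in> vcarrier V" "f (\<Sum>p\<leftarrow>ps. g p) = (\<Sum>p\<leftarrow>ps. f (g p))"
    by auto
qed

lemma bilinear_onD:
  assumes "bilinear_on V W X f"
  shows "w \<in> vcarrier W \<Longrightarrow> linmap V X (\<lambda>v. f v w)" "v \<in> vcarrier V \<Longrightarrow> linmap W X (f v)"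
  using assms by (auto simp: bilinear_on_def)

lemma bilinear_onI:
  assumes "\<And>w. w \<in> vcarrier W \<Longrightarrow> linmap V X (\<lambda>v. f v w)"
    and "\<And>v. v \<in> vcarrier V \<Longrightarrow> linmap W X (\<lambda>w. f v w)"
  shows "bilinear_on V W X f"
  using assms by (auto simp: bilinear_on_def)

lemma bilinear_form_imp_bilinear_on: "bilinear_form V W \<beta> \<Longrightarrow> bilinear_on V W scalars \<beta>"
  by (auto simp: bilinear_form_def bilinear_on_def linmap_def Vector_Spaces.linear_iff)

lemma tensor_in_tensor_space:
  "v \<in> vcarrier V \<Longrightarrow> w \<in> vcarrier W \<Longrightarrow> (v \<otimes>\<^bsub>V,W\<^esub> w) \<in> vcarrier (V \<otimes>\<^sub>V W)"
proof -
  interpret vector_space tscale by (rule vector_space_tscale)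
  show "v \<in> vcarrier V \<Longrightarrow> w \<in> vcarrier W \<Longrightarrow> (v \<otimes>\<^bsub>V,W\<^esub> w) \<in> vcarrier (V \<otimes>\<^sub>V W)"
    by (auto simp: tensor_space_def intro!: span_base)
qed

lemma sum_list_apply: "(\<Sum>p\<leftarrow>ps. g p) \<beta> = (\<Sum>p\<leftarrow>ps. g p \<beta>)"
  by (induction ps) auto

lemma bilinear_on_tensor:
  "bilinear_on V W (V \<otimes>\<^sub>V W) (\<lambda>v w. v \<otimes>\<^bsub>V,W\<^esub> w)"
proof -
  have "bilinear_form V W \<beta> \<Longrightarrow> \<beta> (x + y) w = \<beta> x w + \<beta> y w"
    "bilinear_form V W \<beta> \<Longrightarrow> \<beta> (vscale V c x) w = c * \<beta> x w"
    "bilinear_form V W \<beta> \<Longrightarrow> \<beta> x (w + z) = \<beta> x w + \<beta> x z"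
    "bilinear_form V W \<beta> \<Longrightarrow> \<beta> x (vscale W c w) = c * \<beta> x w" for \<beta> x y w z c
    by (auto simp: bilinear_form_def Vector_Spaces.linear_iff)
  then show ?thesis
    by (simp add: bilinear_on_def linmap_def tensor_in_tensor_space)
      (simp add: tensor_def tscale_def fun_eq_iff)
qed

lemma tensor_eqI:
  assumes V: "is_vspace V" and "s \<in> vcarrier (V \<otimes>\<^sub>V W)" "t \<in> vcarrier (V \<otimes>\<^sub>V W)"
    and eq: "\<And>\<beta>. bilinear_form V W \<beta> \<Longrightarrow> s \<beta> = t \<beta>"
  shows "s = t"
proof
  fix \<beta>
  have "u \<beta> = 0" if u: "u \<in> vcarrier (V \<otimes>\<^sub>V W)" and b: "\<not> bilinear_form V W \<beta>" for u
  proof -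
    from tensor_space_sum_list[OF V u] obtain ps
      where "u = (\<Sum>(v, w)\<leftarrow>ps. v \<otimes>\<^bsub>V,W\<^esub> w)" by metis
    then show ?thesis
      by (simp add: sum_list_apply case_prod_beta tensor_def b)
  qed
  with assms show "s \<beta> = t \<beta>" by metis
qed

lemma sweedler_tensor:
  assumes "is_vspace V" "is_vspace W" "is_vspace X" "bilinear_on V W X f"
    and "v \<in> vcarrier V" "w \<in> vcarrier W"
  shows "sweedler V W (v \<otimes>\<^bsub>V,W\<^esub> w) f = f v w"
  using sweedler_sum_list[OF assms(1-4), of "[(v, w)]"] assms(5,6) by simp

lemma linmap_sweedler:
  assumes V: "is_vspace V" and W: "is_vspace W" and X: "is_vspace X" and f: "bilinear_on V W X f"
  shows "linmap (V \<otimes>\<^sub>V W) X (\<lambda>t. sweedler V W t f)"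
  unfolding linmap_def
proof (intro conjI ballI allI)
  note sw = sweedler_sum_list[OF V W X f]
  have fX: "f v w \<in> vcarrier X" if "v \<in> vcarrier V" "w \<in> vcarrier W" for v w
    using bilinear_onD(2)[OF f that(1)] that(2) by (rule linmapD)
  fix s assume "s \<in> vcarrier (V \<otimes>\<^sub>V W)"
  then obtain ps where ps: "set ps \<subseteq> vcarrier V \<times> vcarrier W" "s = (\<Sum>(v, w)\<leftarrow>ps. v \<otimes>\<^bsub>V,W\<^esub> w)"
    using tensor_space_sum_list[OF V] by metis
  have "(\<Sum>(v, w)\<leftarrow>qs. f v w) \<in> vcarrier X" if "set qs \<subseteq> vcarrier V \<times> vcarrier W" for qs
    using that by (induction qs) (auto simp: is_vspaceD[OF X] fX)
  then show "sweedler V W s f \<in> vcarrier X" using ps by (simp add: sw)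
  fix c
  let ?cs = "map (\<lambda>(v, w). (vscale V c v, w)) ps"
  have "vscale (V \<otimes>\<^sub>V W) c (\<Sum>(v, w)\<leftarrow>ps. v \<otimes>\<^bsub>V,W\<^esub> w) = (\<Sum>(v, w)\<leftarrow>?cs. v \<otimes>\<^bsub>V,W\<^esub> w)"
    using ps(1) by (induction ps)
      (auto simp: is_vspaceD[OF is_vspace_tensor_space] linmapD(3)[OF bilinear_onD(1)[OF bilinear_on_tensor]]
        simp del: vscale_tensor_space)
  moreover have "(\<Sum>(v, w)\<leftarrow>?cs. f v w) = vscale X c (\<Sum>(v, w)\<leftarrow>ps. f v w)"
    using ps(1) by (induction ps) (auto simp: is_vspaceD[OF X] linmapD(3)[OF bilinear_onD(1)[OF f]])
  moreover have "set ?cs \<subseteq> vcarrier V \<times> vcarrier W"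
    using ps(1) by (auto simp: is_vspaceD[OF V])
  ultimately show "sweedler V W (vscale (V \<otimes>\<^sub>V W) c s) f = vscale X c (sweedler V W s f)"
    using ps sw by metis
  fix t assume "t \<in> vcarrier (V \<otimes>\<^sub>V W)"
  then obtain qs where qs: "set qs \<subseteq> vcarrier V \<times> vcarrier W" "t = (\<Sum>(v, w)\<leftarrow>qs. v \<otimes>\<^bsub>V,W\<^esub> w)"
    using tensor_space_sum_list[OF V] by metis
  show "sweedler V W (s + t) f = sweedler V W s f + sweedler V W t f"
    using sw[of "ps @ qs"] sw[of ps] sw[of qs] ps qs by simp
qed

lemma sweedler_linmap:
  assumes V: "is_vspace V" and W: "is_vspace W" and X: "is_vspace X" and Y: "is_vspace Y"
    and f: "bilinear_on V W X f" and g: "linmap X Y g" and t: "t \<in> vcarrier (V \<otimes>\<^sub>V W)"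
  shows "g (sweedler V W t f) = sweedler V W t (\<lambda>v w. g (f v w))"
proof -
  obtain ps where ps: "set ps \<subseteq> vcarrier V \<times> vcarrier W" "t = (\<Sum>(v, w)\<leftarrow>ps. v \<otimes>\<^bsub>V,W\<^esub> w)"
    using t tensor_space_sum_list[OF V] by metis
  have fX: "f v w \<in> vcarrier X" if "v \<in> vcarrier V" "w \<in> vcarrier W" for v w
    using bilinear_onD(2)[OF f that(1)] that(2) by (rule linmapD)
  have "bilinear_on V W Y (\<lambda>v w. g (f v w))"
    using f g fX by (auto simp: bilinear_on_def linmap_def)
  note sw = sweedler_sum_list[OF V W Y this ps(1)] sweedler_sum_list[OF V W X f ps(1)]
  have "g (\<Sum>p\<leftarrow>ps. case p of (v, w) \<Rightarrow> f v w) = (\<Sum>p\<leftarrow>ps. g (case p of (v, w) \<Rightarrow> f v w))"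
    using ps(1) fX by (intro linmap_sum_list(2)[OF g X]) auto
  moreover have "(\<lambda>p. g (case p of (v, w) \<Rightarrow> f v w)) = (\<lambda>(v, w). g (f v w))"
    by auto
  ultimately show ?thesis
    unfolding ps(2) sw by (simp only: cond_case_prod_eta)
qed

lemma linmap_tensor_space_eqI:
  assumes V: "is_vspace V" and f: "linmap (V \<otimes>\<^sub>V W) X f" and g: "linmap (V \<otimes>\<^sub>V W) X g"
    and eq: "\<And>v w. v \<in> vcarrier V \<Longrightarrow> w \<in> vcarrier W \<Longrightarrow> f (v \<otimes>\<^bsub>V,W\<^esub> w) = g (v \<otimes>\<^bsub>V,W\<^esub> w)"
    and t: "t \<in> vcarrier (V \<otimes>\<^sub>V W)"
  shows "f t = g t"
proof -
  obtain ps where ps: "set ps \<subseteq> vcarrier V \<times> vcarrier W" "t = (\<Sum>(v, w)\<leftarrow>ps. v \<otimes>\<^bsub>V,W\<^esub> w)"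
    using t tensor_space_sum_list[OF V] by metis
  have "(\<Sum>p\<leftarrow>ps. f (case p of (v, w) \<Rightarrow> v \<otimes>\<^bsub>V,W\<^esub> w)) = (\<Sum>p\<leftarrow>ps. g (case p of (v, w) \<Rightarrow> v \<otimes>\<^bsub>V,W\<^esub> w))"
    using ps(1) eq by (intro arg_cong[where f = sum_list] map_cong) auto
  moreover have "(case p of (v, w) \<Rightarrow> v \<otimes>\<^bsub>V,W\<^esub> w) \<in> vcarrier (V \<otimes>\<^sub>V W)" if "p \<in> set ps" for p
    using ps(1) that by (auto intro: tensor_in_tensor_space)
  ultimately show ?thesis
    unfolding ps(2) by (simp only: linmap_sum_list(2)[OF f is_vspace_tensor_space]
        linmap_sum_list(2)[OF g is_vspace_tensor_space])
qed

lemma linmap_eval: "linmap (V \<otimes>\<^sub>V W) scalars (\<lambda>t. t \<beta>)"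
  by (auto simp: linmap_def tscale_def)

lemma eval_eq_sweedler:
  assumes "is_vspace V" "is_vspace W" "t \<in> vcarrier (V \<otimes>\<^sub>V W)" "bilinear_form V W \<beta>"
  shows "t \<beta> = sweedler V W t \<beta>"
proof (rule linmap_tensor_space_eqI[OF assms(1) linmap_eval _ _ assms(3)])
  have b: "bilinear_on V W scalars \<beta>"
    by (rule bilinear_form_imp_bilinear_on[OF assms(4)])
  show "(v \<otimes>\<^bsub>V,W\<^esub> w) \<beta> = sweedler V W (v \<otimes>\<^bsub>V,W\<^esub> w) \<beta>"
    if "v \<in> vcarrier V" "w \<in> vcarrier W" for v w
    using sweedler_tensor[OF assms(1,2) is_vspace_scalars b that] assms(4) by (simp add: tensor_def)
  show "linmap (V \<otimes>\<^sub>V W) scalars (\<lambda>t. sweedler V W t \<beta>)"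
    by (intro linmap_sweedler assms is_vspace_scalars b)
qed

text \<open>
  Tensor products and Sweedler sums depend only on carrier and scalar multiplication, not on further
  record fields.
\<close>

lemma same_space:
  assumes "vcarrier V = vcarrier V'" "vscale V = vscale V'"
    and "vcarrier W = vcarrier W'" "vscale W = vscale W'"
  shows "(v \<otimes>\<^bsub>V,W\<^esub> w) = (v \<otimes>\<^bsub>V',W'\<^esub> w)" "V \<otimes>\<^sub>V W = V' \<otimes>\<^sub>V W'"
    and "sweedler V W = sweedler V' W'"
proof -
  have "bilinear_form V W = bilinear_form V' W'"
    by (simp add: fun_eq_iff bilinear_form_def assms)
  then have *: "(v \<otimes>\<^bsub>V,W\<^esub> w) = (v \<otimes>\<^bsub>V',W'\<^esub> w)" for v w
    by (simp add: tensor_def)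
  then show "(v \<otimes>\<^bsub>V,W\<^esub> w) = (v \<otimes>\<^bsub>V',W'\<^esub> w)" "V \<otimes>\<^sub>V W = V' \<otimes>\<^sub>V W'"
    by (simp_all add: tensor_space_def assms)
  show "sweedler V W = sweedler V' W'"
    by (intro ext) (simp add: sweedler_def * assms)
qed

text \<open>Introduction rules that reduce linearity of a composite expression to that of its parts.\<close>

named_theorems linear_intros

lemma lin_id [linear_intros]: "linmap V V (\<lambda>x. x)"
  by (auto simp: linmap_def)

lemma linmap_comp: "linmap V W g \<Longrightarrow> linmap U V f \<Longrightarrow> linmap U W (\<lambda>u. g (f u))"
  by (auto simp: linmap_def)

lemma lin_tensor_left [linear_intros]:
  "linmap U V f \<Longrightarrow> w \<in> vcarrier W \<Longrightarrow> linmap U (V \<otimes>\<^sub>V W) (\<lambda>u. f u \<otimes>\<^bsub>V,W\<^esub> w)"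
  by (rule linmap_comp[OF bilinear_onD(1)[OF bilinear_on_tensor]])

lemma lin_tensor_right [linear_intros]:
  "linmap U W f \<Longrightarrow> v \<in> vcarrier V \<Longrightarrow> linmap U (V \<otimes>\<^sub>V W) (\<lambda>u. v \<otimes>\<^bsub>V,W\<^esub> f u)"
  by (rule linmap_comp[OF bilinear_onD(2)[OF bilinear_on_tensor]])

lemma lin_tensor_left_eval [linear_intros]:
  "linmap U V f \<Longrightarrow> w \<in> vcarrier W \<Longrightarrow> linmap U scalars (\<lambda>u. (f u \<otimes>\<^bsub>V,W\<^esub> w) B)"
  using linmap_comp[of "V \<otimes>\<^sub>V W" scalars "\<lambda>t. t B"] linmap_eval lin_tensor_left by blast

lemma lin_tensor_right_eval [linear_intros]:
  "linmap U W f \<Longrightarrow> v \<in> vcarrier V \<Longrightarrow> linmap U scalars (\<lambda>u. (v \<otimes>\<^bsub>V,W\<^esub> f u) B)"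
  using linmap_comp[of "V \<otimes>\<^sub>V W" scalars "\<lambda>t. t B"] linmap_eval lin_tensor_right by blast

lemma lin_sweedler [linear_intros]:
  assumes "linmap U (V \<otimes>\<^sub>V W) T" "is_vspace V" "is_vspace W" "is_vspace X" "bilinear_on V W X f"
  shows "linmap U X (\<lambda>u. sweedler V W (T u) f)"
  using linmap_comp[OF linmap_sweedler assms(1)] assms by blast

lemma lin_sweedler_param [linear_intros]:
  assumes t: "t \<in> vcarrier (V \<otimes>\<^sub>V W)" and V: "is_vspace V" and W: "is_vspace W" and X: "is_vspace X"
    and U: "is_vspace U"
    and b: "\<And>u. u \<in> vcarrier U \<Longrightarrow> bilinear_on V W X (f u)"
    and l: "\<And>v w. v \<in> vcarrier V \<Longrightarrow> w \<in> vcarrier W \<Longrightarrow> linmap U X (\<lambda>u. f u v w)"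
  shows "linmap U X (\<lambda>u. sweedler V W t (f u))"
proof -
  obtain ps where ps: "set ps \<subseteq> vcarrier V \<times> vcarrier W" "t = (\<Sum>(v, w)\<leftarrow>ps. v \<otimes>\<^bsub>V,W\<^esub> w)"
    using t tensor_space_sum_list[OF V] by metis
  have sw: "sweedler V W t (f u) = (\<Sum>(v, w)\<leftarrow>ps. f u v w)" if "u \<in> vcarrier U" for u
    unfolding ps(2) by (rule sweedler_sum_list[OF V W X b[OF that] ps(1)])
  have "linmap U X (\<lambda>u. (\<Sum>(v, w)\<leftarrow>ps. f u v w))"
    using ps(1)
  proof (induction ps)
    case Nil
    then show ?case using X by (simp add: linmap_def is_vspaceD)
  next
    case (Cons p ps)
    obtain v w where p: "p = (v, w)" by (cases p)
    with Cons have "linmap U X (\<lambda>u. f u v w)" "linmap U X (\<lambda>u. (\<Sum>(v, w)\<leftarrow>ps. f u v w))"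
      using l by auto
    then show ?case
      using X unfolding p by (simp add: linmap_def is_vspaceD algebra_simps)
  qed
  then show ?thesis
    using sw is_vspaceD[OF U] by (simp add: linmap_def)
qed

lemma lin_mult_left [linear_intros]: "linmap U scalars f \<Longrightarrow> linmap U scalars (\<lambda>u. f u * c)"
  and lin_mult_right [linear_intros]: "linmap U scalars f \<Longrightarrow> linmap U scalars (\<lambda>u. c * f u)"
  by (auto simp: linmap_def algebra_simps)


section \<open>Two-tensors as functionals on bilinear forms\<close>

text \<open>A vector space whose carrier is the whole type.\<close>

locale full_vspace =
  fixes H :: "('k::field, 'h::ab_group_add, 'z) vspace_scheme"
  assumes carrier: "vcarrier H = UNIV" and vector_space: "vector_space (vscale H)"
begin

abbreviation "HH \<equiv> H \<otimes>\<^sub>V H"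

abbreviation "lin \<equiv> linmap H scalars"

abbreviation "bilin \<equiv> bilinear_on H H scalars"

lemma is_vspace_H: "is_vspace H"
proof -
  interpret vector_space "vscale H" by (rule vector_space)
  show ?thesis
    by (simp add: is_vspace_def carrier vector_space)
qed

lemma in_carrier [simp]: "x \<in> vcarrier H"
  by (simp add: carrier)

lemmas vspaces = is_vspace_H is_vspace_scalars is_vspace_tensor_space

lemma bilinear_form_iff: "bilinear_form H H \<beta> \<longleftrightarrow> bilin \<beta>"
  using vector_space vector_space_times[where 'k = 'k]
  by (auto simp: bilinear_form_def bilinear_on_def linmap_def Vector_Spaces.linear_iff)

lemma bilinI: "(\<And>y. lin (\<lambda>x. f x y)) \<Longrightarrow> (\<And>x. lin (\<lambda>y. f x y)) \<Longrightarrow> bilin f"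
  by (simp add: bilinear_on_def)

lemma eval_tensor: "bilin \<beta> \<Longrightarrow> (a \<otimes>\<^bsub>H,H\<^esub> b) \<beta> = \<beta> a b"
  by (simp add: tensor_def bilinear_form_iff)

lemma sweedler_eval: "t \<in> vcarrier HH \<Longrightarrow> bilin \<beta> \<Longrightarrow> sweedler H H t \<beta> = t \<beta>"
  by (rule eval_eq_sweedler[symmetric]) (simp_all add: vspaces bilinear_form_iff)

lemma eval_sum_list:
  assumes "t \<in> vcarrier HH"
  obtains ps where "\<And>\<beta>. bilin \<beta> \<Longrightarrow> t \<beta> = (\<Sum>(a, b)\<leftarrow>ps. \<beta> a b)"
proof -
  from tensor_space_sum_list[OF is_vspace_H assms] obtain ps
    where "t = (\<Sum>(a, b)\<leftarrow>ps. a \<otimes>\<^bsub>H,H\<^esub> b)" by metis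
  then have "t \<beta> = (\<Sum>(a, b)\<leftarrow>ps. \<beta> a b)" if "bilin \<beta>" for \<beta>
    by (simp add: sum_list_apply split_def eval_tensor[OF that])
  with that show ?thesis .
qed

text \<open>
  The next two rules are not among the general introduction rules: with a schematic tensor they would
  unify with every scalar-valued expression. They are declared below for particular tensors.
\<close>

lemma lin_eval: "linmap U HH T \<Longrightarrow> linmap U scalars (\<lambda>u. T u \<beta>)"
  using linmap_comp[of HH scalars "\<lambda>t. t \<beta>" U T] linmap_eval by blast

lemma lin_eval_param:
  assumes "t \<in> vcarrier HH" "is_vspace U" "\<And>u. u \<in> vcarrier U \<Longrightarrow> bilin (f u)"
    and "\<And>a b. linmap U scalars (\<lambda>u. f u a b)"
  shows "linmap U scalars (\<lambda>u. t (f u))"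
proof -
  have "linmap U scalars (\<lambda>u. sweedler H H t (f u))"
    by (rule lin_sweedler_param) (simp_all add: assms vspaces)
  then show ?thesis
    using assms is_vspaceD[OF assms(2)] by (simp add: linmap_def sweedler_eval)
qed

lemma bilin_arg1: "bilin \<beta> \<Longrightarrow> linmap U H g \<Longrightarrow> linmap U scalars (\<lambda>u. \<beta> (g u) y)"
  and bilin_arg2: "bilin \<beta> \<Longrightarrow> linmap U H g \<Longrightarrow> linmap U scalars (\<lambda>u. \<beta> y (g u))"
  by (auto simp: bilinear_on_def linmap_def)

lemma lin_arg: "lin f \<Longrightarrow> linmap U H g \<Longrightarrow> linmap U scalars (\<lambda>u. f (g u))"
  by (auto simp: linmap_def)

lemma eval_mult_left: 
  assumes "t \<in> vcarrier HH" "bilin \<beta>"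
  shows "t (\<lambda>a b. c * \<beta> a b) = c * t \<beta>"
proof -
  have b: "bilin (\<lambda>a b. c * \<beta> a b)"
    using assms(2) by (auto simp: bilinear_on_def linmap_def algebra_simps)
  obtain ps where ps: "\<And>\<beta>. bilin \<beta> \<Longrightarrow> t \<beta> = (\<Sum>(a, b)\<leftarrow>ps. \<beta> a b)"
    using eval_sum_list[OF assms(1)] by metis
  show ?thesis
    unfolding ps[OF b] ps[OF assms(2)] by (simp add: sum_list_const_mult split_def)
qed

lemma eval_swap:
  assumes s: "s \<in> vcarrier HH" and t: "t \<in> vcarrier HH"
    and b1: "\<And>a b. bilin (f a b)" and b2: "\<And>c d. bilin (\<lambda>a b. f a b c d)"
  shows "s (\<lambda>a b. t (\<lambda>c d. f a b c d)) = t (\<lambda>c d. s (\<lambda>a b. f a b c d))"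
proof -
  have 1: "bilin (\<lambda>a b. t (\<lambda>c d. f a b c d))"
    using bilinear_onD[OF b1] bilinear_onD[OF b2] by (intro bilinI lin_eval_param[OF t]) (simp_all add: vspaces b1)
  have 2: "bilin (\<lambda>c d. s (\<lambda>a b. f a b c d))"
    using bilinear_onD[OF b1] bilinear_onD[OF b2] by (intro bilinI lin_eval_param[OF s]) (simp_all add: vspaces b2)
  obtain ps where ps: "\<And>\<beta>. bilin \<beta> \<Longrightarrow> s \<beta> = (\<Sum>(a, b)\<leftarrow>ps. \<beta> a b)"
    using eval_sum_list[OF s] by metis
  obtain qs where qs: "\<And>\<beta>. bilin \<beta> \<Longrightarrow> t \<beta> = (\<Sum>(a, b)\<leftarrow>qs. \<beta> a b)"
    using eval_sum_list[OF t] by metis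
  have "(\<Sum>(a, b)\<leftarrow>ps. \<Sum>(c, d)\<leftarrow>qs. f a b c d) = (\<Sum>(c, d)\<leftarrow>qs. \<Sum>(a, b)\<leftarrow>ps. f a b c d)"
    by (induction ps) (auto simp: sum_list_addf split_def)
  then show ?thesis
    using ps[OF 1] qs[OF 2] ps[OF b2] qs[OF b1] by (simp add: split_def)
qed

lemma tensor_eqI_HH: "s \<in> vcarrier HH \<Longrightarrow> t \<in> vcarrier HH \<Longrightarrow> (\<And>\<beta>. bilin \<beta> \<Longrightarrow> s \<beta> = t \<beta>) \<Longrightarrow> s = t"
  by (rule tensor_eqI[OF is_vspace_H]) (auto simp: bilinear_form_iff)

text \<open>Trilinear forms, as linear in any two arguments with the third one fixed.\<close>

definition trilin :: "('h \<Rightarrow> 'h \<Rightarrow> 'h \<Rightarrow> 'k) \<Rightarrow> bool" where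
  "trilin \<tau> \<longleftrightarrow> (\<forall>a. bilin (\<tau> a)) \<and> (\<forall>b. bilin (\<lambda>a c. \<tau> a b c)) \<and> (\<forall>c. bilin (\<lambda>a b. \<tau> a b c))"

lemma trilin_arg1: "trilin \<tau> \<Longrightarrow> linmap U H g \<Longrightarrow> linmap U scalars (\<lambda>u. \<tau> (g u) y z)"
  and trilin_arg2: "trilin \<tau> \<Longrightarrow> linmap U H g \<Longrightarrow> linmap U scalars (\<lambda>u. \<tau> x (g u) z)"
  and trilin_arg3: "trilin \<tau> \<Longrightarrow> linmap U H g \<Longrightarrow> linmap U scalars (\<lambda>u. \<tau> x y (g u))"
  by (auto simp: trilin_def bilinear_on_def linmap_def)

end

section \<open>Universal R-matrices from involutive braidings\<close>

text \<open>
  Multiplication and comultiplication are parameters, so that \<open>H\<close> and its opposite and co-opposite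
  are both instances. The structure comprises neither coassociativity nor the counit axioms nor an antipode.
\<close>

locale bialgebra_structure = full_vspace H
  for H :: "('k::field, 'h::ab_group_add, 'z) vspace_scheme" +
  fixes mul :: "'h \<Rightarrow> 'h \<Rightarrow> 'h" (infixl \<open>\<bullet>\<close> 70)
    and one :: 'h (\<open>\<one>\<close>)
    and \<Delta> :: "'h \<Rightarrow> ('k, 'h, 'h) tensor"
    and \<epsilon> :: "'h \<Rightarrow> 'k"
  assumes mul_bilinear: "bilinear_on H H H (\<bullet>)"
    and mul_assoc: "a \<bullet> b \<bullet> c = a \<bullet> (b \<bullet> c)"
    and mul_one_left [simp]: "\<one> \<bullet> a = a"
    and mul_one_right [simp]: "a \<bullet> \<one> = a"
    and comult_linear: "linmap H HH \<Delta>"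
    and counit_linear: "lin \<epsilon>"
    and comult_mul: "bilin \<beta> \<Longrightarrow>
      \<Delta> (g \<bullet> h) \<beta> = \<Delta> g (\<lambda>a b. \<Delta> h (\<lambda>c d. \<beta> (a \<bullet> c) (b \<bullet> d)))"
    and comult_one: "bilin \<beta> \<Longrightarrow> \<Delta> \<one> \<beta> = \<beta> \<one> \<one>"
    and counit_mul: "\<epsilon> (g \<bullet> h) = \<epsilon> g * \<epsilon> h"
    and counit_one [simp]: "\<epsilon> \<one> = 1"
begin

lemma lin_mul_left [linear_intros]: "linmap U H f \<Longrightarrow> linmap U H (\<lambda>u. f u \<bullet> c)"
  and lin_mul_right [linear_intros]: "linmap U H f \<Longrightarrow> linmap U H (\<lambda>u. c \<bullet> f u)"
  using mul_bilinear by (auto simp: bilinear_on_def linmap_def)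

lemma lin_comult [linear_intros]: "linmap U H f \<Longrightarrow> linmap U HH (\<lambda>u. \<Delta> (f u))"
  by (rule linmap_comp[OF comult_linear])

lemma lin_counit [linear_intros]: "linmap U H f \<Longrightarrow> linmap U scalars (\<lambda>u. \<epsilon> (f u))"
  by (rule linmap_comp[OF counit_linear])

lemma comult_in [simp]: "\<Delta> h \<in> vcarrier HH"
  using linmapD(1)[OF comult_linear] by simp

lemmas lin_comult_eval [linear_intros] = lin_eval[OF lin_comult]

lemmas lin_comult_param [linear_intros] = lin_eval_param[OF comult_in]

text \<open>
  \<open>triangular_form Q\<close> says that \<open>R = Q\<^sub>2\<^sub>1\<close> is a triangular structure. The conditions are,
  in this order: \<open>Q \<Delta>\<^sup>c\<^sup>o\<^sup>p(h) = \<Delta>(h) Q\<close>; \<open>Q Q\<^sub>2\<^sub>1 = 1\<close>; \<open>Q\<^sub>2\<^sub>1 Q = 1\<close>;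
  \<open>(\<Delta> \<otimes> id) Q = Q\<^sub>2\<^sub>3 Q\<^sub>1\<^sub>3\<close>; \<open>(id \<otimes> \<Delta>) Q = Q\<^sub>1\<^sub>2 Q\<^sub>1\<^sub>3\<close>; and the
  two counit equations.
\<close>

definition triangular_form :: "('k, 'h, 'h) tensor \<Rightarrow> bool" where
  "triangular_form Q \<longleftrightarrow> Q \<in> vcarrier HH
    \<and> (\<forall>h \<beta>. bilin \<beta> \<longrightarrow> \<Delta> h (\<lambda>h1 h2. Q (\<lambda>a b. \<beta> (a \<bullet> h2) (b \<bullet> h1)))
        = \<Delta> h (\<lambda>h1 h2. Q (\<lambda>a b. \<beta> (h1 \<bullet> a) (h2 \<bullet> b))))
    \<and> (\<forall>\<beta>. bilin \<beta> \<longrightarrow> Q (\<lambda>a b. Q (\<lambda>c d. \<beta> (c \<bullet> b) (d \<bullet> a))) = \<beta> \<one> \<one>)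
    \<and> (\<forall>\<beta>. bilin \<beta> \<longrightarrow> Q (\<lambda>a b. Q (\<lambda>c d. \<beta> (b \<bullet> c) (a \<bullet> d))) = \<beta> \<one> \<one>)
    \<and> (\<forall>\<tau>. trilin \<tau> \<longrightarrow> Q (\<lambda>a b. \<Delta> a (\<lambda>a1 a2. \<tau> a1 a2 b)) = Q (\<lambda>a b. Q (\<lambda>c d. \<tau> a c (d \<bullet> b))))
    \<and> (\<forall>\<tau>. trilin \<tau> \<longrightarrow> Q (\<lambda>a b. \<Delta> b (\<lambda>b1 b2. \<tau> a b1 b2)) = Q (\<lambda>a b. Q (\<lambda>c d. \<tau> (a \<bullet> c) b d)))
    \<and> (\<forall>f. lin f \<longrightarrow> Q (\<lambda>a b. \<epsilon> a * f b) = f \<one>)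
    \<and> (\<forall>f. lin f \<longrightarrow> Q (\<lambda>a b. \<epsilon> b * f a) = f \<one>)"

text \<open>
  Uniqueness of inverses in \<open>H \<otimes> H \<otimes> H\<close>: with \<open>X = (id \<otimes> \<Delta>) Q\<^sub>2\<^sub>1\<close>, which is
  \<open>Q\<^sub>3\<^sub>1 Q\<^sub>2\<^sub>1\<close> by the first hexagon equation, \<open>Q\<^sub>1\<^sub>2 Q\<^sub>1\<^sub>3\<close> is a left inverse and
  \<open>Y = (id \<otimes> \<Delta>) Q\<close> a right inverse of \<open>X\<close>. The element \<open>Q\<^sub>1\<^sub>2 Q\<^sub>1\<^sub>3 X Y\<close> is computed in two ways.
\<close>

lemma comult_right_factor:
  assumes Q: "Q \<in> vcarrier HH"
    and inv: "\<And>\<beta>. bilin \<beta> \<Longrightarrow> Q (\<lambda>a b. Q (\<lambda>c d. \<beta> (c \<bullet> b) (d \<bullet> a))) = \<beta> \<one> \<one>"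
    and inv': "\<And>\<beta>. bilin \<beta> \<Longrightarrow> Q (\<lambda>a b. Q (\<lambda>c d. \<beta> (b \<bullet> c) (a \<bullet> d))) = \<beta> \<one> \<one>"
    and hex: "\<And>\<tau>. trilin \<tau> \<Longrightarrow>
      Q (\<lambda>a b. \<Delta> a (\<lambda>a1 a2. \<tau> a1 a2 b)) = Q (\<lambda>a b. Q (\<lambda>c d. \<tau> a c (d \<bullet> b)))"
    and \<tau>: "trilin \<tau>"
  shows "Q (\<lambda>a b. \<Delta> b (\<lambda>b1 b2. \<tau> a b1 b2)) = Q (\<lambda>a b. Q (\<lambda>c d. \<tau> (a \<bullet> c) b d))"
proof -
  note [simp] = Q
  note [intro!] = bilinI linear_intros lin_eval_param[OF Q] vspaces trilin_arg1[OF \<tau>] trilin_arg2[OF \<tau>] trilin_arg3[OF \<tau>]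
  \<comment> \<open>\<open>G x y z\<close> is \<open>\<tau>\<close> at \<open>(x \<otimes> y \<otimes> z) Y\<close>, and \<open>P\<close> is \<open>\<tau>\<close> at \<open>Q\<^sub>1\<^sub>2 Q\<^sub>1\<^sub>3 X Y\<close>.\<close>
  define G where "G x y z = Q (\<lambda>p q. \<Delta> q (\<lambda>q1 q2. \<tau> (x \<bullet> p) (y \<bullet> q1) (z \<bullet> q2)))" for x y z
  have G: "trilin G" unfolding G_def trilin_def by auto
  note [intro!] = trilin_arg1[OF G] trilin_arg2[OF G] trilin_arg3[OF G]
  define P where "P = Q (\<lambda>a b. Q (\<lambda>c d. Q (\<lambda>e f. \<Delta> e (\<lambda>e1 e2.
    G (a \<bullet> c \<bullet> f) (b \<bullet> e1) (d \<bullet> e2)))))"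
  \<comment> \<open>\<open>X Y = (id \<otimes> \<Delta>) (Q\<^sub>2\<^sub>1 Q) = 1\<close>\<close>
  have "Q (\<lambda>e f. \<Delta> e (\<lambda>e1 e2. G (x \<bullet> f) (b \<bullet> e1) (d \<bullet> e2))) = \<tau> x b d" for x b d
  proof -
    have 1: "\<Delta> e (\<lambda>e1 e2. G (x \<bullet> f) (b \<bullet> e1) (d \<bullet> e2))
      = Q (\<lambda>p q. \<Delta> e (\<lambda>e1 e2. \<Delta> q (\<lambda>q1 q2. \<tau> (x \<bullet> f \<bullet> p) (b \<bullet> e1 \<bullet> q1) (d \<bullet> e2 \<bullet> q2))))" for e f
      unfolding G_def by (rule eval_swap[of "\<Delta> e" Q]) auto
    have 2: "\<Delta> e (\<lambda>e1 e2. \<Delta> q (\<lambda>q1 q2. \<tau> (x \<bullet> f \<bullet> p) (b \<bullet> e1 \<bullet> q1) (d \<bullet> e2 \<bullet> q2)))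
      = \<Delta> (e \<bullet> q) (\<lambda>y z. \<tau> (x \<bullet> (f \<bullet> p)) (b \<bullet> y) (d \<bullet> z))" for e f p q
    proof -
      have "bilin (\<lambda>y z. \<tau> (x \<bullet> (f \<bullet> p)) (b \<bullet> y) (d \<bullet> z))" by auto
      from comult_mul[OF this, of e q] show ?thesis by (simp add: mul_assoc)
    qed
    have b: "bilin (\<lambda>u v. \<Delta> v (\<lambda>y z. \<tau> (x \<bullet> u) (b \<bullet> y) (d \<bullet> z)))" by auto
    have b': "bilin (\<lambda>y z. \<tau> x (b \<bullet> y) (d \<bullet> z))" by auto
    show ?thesis
      unfolding 1 2 using inv'[OF b] comult_one[OF b'] by simp
  qed
  then have "P = Q (\<lambda>a b. Q (\<lambda>c d. \<tau> (a \<bullet> c) b d))"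
    by (simp add: P_def)
  \<comment> \<open>\<open>Q\<^sub>1\<^sub>2 Q\<^sub>1\<^sub>3 X = Q\<^sub>1\<^sub>2 (Q\<^sub>1\<^sub>3 Q\<^sub>3\<^sub>1) Q\<^sub>2\<^sub>1 = 1\<close>\<close>
  moreover have "P = Q (\<lambda>p q. \<Delta> q (\<lambda>q1 q2. \<tau> p q1 q2))"
  proof -
    have 1: "Q (\<lambda>e f. \<Delta> e (\<lambda>e1 e2. G (x \<bullet> f) (b \<bullet> e1) (d \<bullet> e2)))
      = Q (\<lambda>e f. Q (\<lambda>g h. G (x \<bullet> (h \<bullet> f)) (b \<bullet> e) (d \<bullet> g)))" for x b d
    proof -
      have "trilin (\<lambda>y z w. G (x \<bullet> w) (b \<bullet> y) (d \<bullet> z))" by (auto simp: trilin_def)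
      from hex[OF this] show ?thesis .
    qed
    have 2: "Q (\<lambda>c d. Q (\<lambda>e f. Q (\<lambda>g h. G (a \<bullet> c \<bullet> (h \<bullet> f)) (b \<bullet> e) (d \<bullet> g))))
      = Q (\<lambda>e f. G (a \<bullet> f) (b \<bullet> e) \<one>)" for a b
    proof -
      have "Q (\<lambda>c d. Q (\<lambda>e f. Q (\<lambda>g h. G (a \<bullet> c \<bullet> (h \<bullet> f)) (b \<bullet> e) (d \<bullet> g))))
        = Q (\<lambda>e f. Q (\<lambda>c d. Q (\<lambda>g h. G (a \<bullet> c \<bullet> (h \<bullet> f)) (b \<bullet> e) (d \<bullet> g))))"
        by (rule eval_swap[of Q Q]) auto
      moreover have "Q (\<lambda>c d. Q (\<lambda>g h. G (a \<bullet> c \<bullet> (h \<bullet> f)) (b \<bullet> e) (d \<bullet> g)))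
        = Q (\<lambda>g h. Q (\<lambda>c d. G (a \<bullet> c \<bullet> (h \<bullet> f)) (b \<bullet> e) (d \<bullet> g)))" for e f
        by (rule eval_swap[of Q Q]) auto
      moreover have "Q (\<lambda>g h. Q (\<lambda>c d. G (a \<bullet> c \<bullet> (h \<bullet> f)) (b \<bullet> e) (d \<bullet> g))) = G (a \<bullet> f) (b \<bullet> e) \<one>" for e f
      proof -
        have "bilin (\<lambda>u v. G (a \<bullet> (u \<bullet> f)) (b \<bullet> e) v)" by auto
        from inv[OF this] show ?thesis by (simp add: mul_assoc)
      qed
      ultimately show ?thesis by simp
    qed
    have "P = Q (\<lambda>a b. Q (\<lambda>e f. G (a \<bullet> f) (b \<bullet> e) \<one>))"
      unfolding P_def 1 2 ..
    also have "\<dots> = Q (\<lambda>e f. Q (\<lambda>a b. G (a \<bullet> f) (b \<bullet> e) \<one>))"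
      by (rule eval_swap[of Q Q]) auto
    also have "\<dots> = G \<one> \<one> \<one>"
    proof -
      have "bilin (\<lambda>u v. G u v \<one>)" by auto
      from inv[OF this] show ?thesis .
    qed
    also have "\<dots> = Q (\<lambda>p q. \<Delta> q (\<lambda>q1 q2. \<tau> p q1 q2))"
      by (simp add: G_def)
    finally show ?thesis .
  qed
  ultimately show ?thesis by simp
qed

text \<open>
  The core of the theorem. The hypotheses on \<open>\<rho>\<close> are the two comodule axioms, the left
  Yetter-Drinfel'd condition for \<open>\<rho>\<close> and multiplication, and that
  \<open>k \<otimes> k' \<mapsto> k\<^sub>-\<^sub>1 k' \<otimes> k\<^sub>0\<close> is an involution. The second conclusion is
  \<open>\<rho> h = \<rho> 1 (1 \<otimes> h)\<close>.
\<close>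

lemma triangular_form_of_involution:
  assumes \<rho>: "linmap H HH \<rho>"
    and coassoc: "\<And>k \<tau>. trilin \<tau> \<Longrightarrow>
      \<rho> k (\<lambda>a n. \<Delta> a (\<lambda>a1 a2. \<tau> a1 a2 n)) = \<rho> k (\<lambda>a n. \<rho> n (\<lambda>b n'. \<tau> a b n'))"
    and counit: "\<And>k f. lin f \<Longrightarrow> \<rho> k (\<lambda>a n. \<epsilon> a * f n) = f k"
    and yd: "\<And>h k \<beta>. bilin \<beta> \<Longrightarrow> \<Delta> h (\<lambda>h1 h2. \<rho> (h1 \<bullet> k) (\<lambda>a n. \<beta> (a \<bullet> h2) n))
      = \<Delta> h (\<lambda>h1 h2. \<rho> k (\<lambda>a n. \<beta> (h1 \<bullet> a) (h2 \<bullet> n)))"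
    and invol: "\<And>k k' \<beta>. bilin \<beta> \<Longrightarrow>
      \<rho> k (\<lambda>a n. \<rho> (a \<bullet> k') (\<lambda>b n'. \<beta> (b \<bullet> n) n')) = \<beta> k k'"
  shows "triangular_form (\<rho> \<one>)"
    and "bilin \<beta> \<Longrightarrow> \<rho> h \<beta> = \<rho> \<one> (\<lambda>a n. \<beta> a (n \<bullet> h))"
proof -
  have \<rho>_in [simp]: "\<rho> h \<in> vcarrier HH" for h
    using linmapD(1)[OF \<rho>] by simp
  note [intro!] = bilinI linear_intros lin_eval[OF linmap_comp[OF \<rho>]] lin_eval_param[OF \<rho>_in] vspaces
  \<comment> \<open>the transpose of the involution, acting on bilinear forms\<close>
  define \<psi> where "\<psi> \<gamma> x y = \<rho> x (\<lambda>a n. \<gamma> (a \<bullet> y) n)" for \<gamma> :: "'h \<Rightarrow> 'h \<Rightarrow> 'k" and x y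
  have \<psi>_bilin: "bilin (\<psi> \<gamma>)" if "bilin \<gamma>" for \<gamma>
    unfolding \<psi>_def by (auto intro!: bilin_arg1[OF that] bilin_arg2[OF that])
  have \<psi>\<psi>: "\<psi> (\<psi> \<gamma>) = \<gamma>" if "bilin \<gamma>" for \<gamma>
    using invol[OF that] by (simp add: \<psi>_def fun_eq_iff)
  have \<psi>_right: "\<psi> \<gamma> x (y \<bullet> h) = \<psi> (\<lambda>u v. \<gamma> (u \<bullet> h) v) x y" for \<gamma> x y h
    by (simp add: \<psi>_def mul_assoc)
  show *: "\<rho> h \<beta> = \<rho> \<one> (\<lambda>a n. \<beta> a (n \<bullet> h))" if b: "bilin \<beta>" for h \<beta>
  proof -
    note [intro!] = bilin_arg1[OF b] bilin_arg2[OF b] bilin_arg1[OF \<psi>_bilin[OF b]] bilin_arg2[OF \<psi>_bilin[OF b]]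
    \<comment> \<open>\<open>\<psi>_right\<close> for the form \<open>\<psi> \<beta>\<close>, then \<open>\<psi>\<close> applied to both sides\<close>
    let ?\<delta> = "\<lambda>u v. \<psi> \<beta> (u \<bullet> h) v"
    have "(\<lambda>x y. \<beta> x (y \<bullet> h)) = \<psi> ?\<delta>"
      using \<psi>_right[of "\<psi> \<beta>"] by (simp add: \<psi>\<psi>[OF b] fun_eq_iff)
    moreover have "bilin ?\<delta>" by auto
    ultimately have "\<psi> (\<lambda>x y. \<beta> x (y \<bullet> h)) \<one> \<one> = ?\<delta> \<one> \<one>"
      by (simp only: \<psi>\<psi>)
    then show ?thesis
      by (simp add: \<psi>_def)
  qed
  let ?Q = "\<rho> \<one>"
  have inv: "?Q (\<lambda>a b. ?Q (\<lambda>c d. \<beta> (c \<bullet> b) (d \<bullet> a))) = \<beta> \<one> \<one>" if b: "bilin \<beta>" for \<beta>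
  proof -
    have "bilin (\<lambda>c d. \<beta> (c \<bullet> b) d)" for b
      by (auto intro!: bilin_arg1[OF b] bilin_arg2[OF b])
    from *[OF this] show ?thesis
      using invol[OF b, of \<one> \<one>] by simp
  qed
  have inv': "?Q (\<lambda>a b. ?Q (\<lambda>c d. \<beta> (b \<bullet> c) (a \<bullet> d))) = \<beta> \<one> \<one>" if b: "bilin \<beta>" for \<beta>
  proof -
    note [intro!] = bilin_arg1[OF b] bilin_arg2[OF b]
    have "?Q (\<lambda>a b. ?Q (\<lambda>c d. \<beta> (b \<bullet> c) (a \<bullet> d))) = ?Q (\<lambda>c d. ?Q (\<lambda>a b. \<beta> (b \<bullet> c) (a \<bullet> d)))"
      by (rule eval_swap[of ?Q ?Q]) auto
    also have "\<dots> = \<beta> \<one> \<one>"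
    proof -
      have "bilin (\<lambda>u v. \<beta> v u)" by auto
      from inv[OF this] show ?thesis .
    qed
    finally show ?thesis .
  qed
  have hex: "?Q (\<lambda>a b. \<Delta> a (\<lambda>a1 a2. \<tau> a1 a2 b)) = ?Q (\<lambda>a b. ?Q (\<lambda>c d. \<tau> a c (d \<bullet> b)))"
    if t: "trilin \<tau>" for \<tau>
  proof -
    have "bilin (\<tau> a)" for a using t by (simp add: trilin_def)
    from *[OF this] show ?thesis using coassoc[OF t, of \<one>] by simp
  qed
  have "\<Delta> h (\<lambda>h1 h2. ?Q (\<lambda>a b. \<beta> (a \<bullet> h2) (b \<bullet> h1))) = \<Delta> h (\<lambda>h1 h2. ?Q (\<lambda>a b. \<beta> (h1 \<bullet> a) (h2 \<bullet> b)))"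
    if b: "bilin \<beta>" for h \<beta>
  proof -
    have "bilin (\<lambda>a n. \<beta> (a \<bullet> c) n)" for c
      by (auto intro!: bilin_arg1[OF b] bilin_arg2[OF b])
    from *[OF this] show ?thesis using yd[OF b, of h \<one>] by simp
  qed
  moreover have "?Q (\<lambda>a b. \<epsilon> b * f a) = f \<one>" if f: "lin f" for f
  proof -
    note [intro!] = lin_arg[OF f]
    \<comment> \<open>the involution evaluated on \<open>\<epsilon> \<otimes> f\<close>\<close>
    have b: "bilin (\<lambda>u v. \<epsilon> u * f v)" by auto
    have "\<rho> a (\<lambda>b n'. \<epsilon> (b \<bullet> n) * f n') = \<epsilon> n * f a" for a n
    proof -
      have "\<rho> a (\<lambda>b n'. \<epsilon> (b \<bullet> n) * f n') = \<rho> a (\<lambda>b n'. \<epsilon> n * (\<epsilon> b * f n'))"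
        by (simp add: counit_mul mult_ac)
      also have "\<dots> = \<epsilon> n * f a"
        by (simp only: eval_mult_left[OF \<rho>_in b] counit[OF f])
      finally show ?thesis .
    qed
    then show ?thesis using invol[OF b, of \<one> \<one>] by simp
  qed
  ultimately show "triangular_form ?Q"
    using inv inv' hex comult_right_factor[OF \<rho>_in inv inv' hex] counit[of _ \<one>]
    by (simp add: triangular_form_def)
qed

end


section \<open>The two bialgebra structures carried by a Hopf algebra\<close>

context hopf_algebra
begin

sublocale full_vspace H
  using carrier vector_space by (rule full_vspace.intro)

lemma eval_linmap_sweedler:
  assumes t: "t \<in> vcarrier HH" and X: "is_vspace X" and T: "bilinear_on H H X T"
    and g: "linmap X scalars g"
  shows "g (sweedler H H t T) = t (\<lambda>a b. g (T a b))"
proof -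
  have "bilin (\<lambda>a b. g (T a b))"
    using bilinear_onD[OF T] by (intro bilinI) (simp_all add: linmap_comp[OF g])
  from sweedler_eval[OF t this] show ?thesis
    using sweedler_linmap[OF vspaces(1) vspaces(1) X vspaces(2) T g t] by simp
qed

lemma eval_sweedler:
  assumes "t \<in> vcarrier HH" and "bilinear_on H H (V \<otimes>\<^sub>V W) T"
  shows "sweedler H H t T B = t (\<lambda>a b. T a b B)"
  by (rule eval_linmap_sweedler[OF assms(1) vspaces(3) assms(2) linmap_eval])

lemma sweedler_in:
  assumes "t \<in> vcarrier HH" and "is_vspace X" and "bilinear_on H H X T"
  shows "sweedler H H t T \<in> vcarrier X"
  by (rule linmapD(1)[OF linmap_sweedler[OF vspaces(1) vspaces(1) assms(2,3)] assms(1)])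

lemma lin_times_left [linear_intros]: "linmap U H f \<Longrightarrow> linmap U H (\<lambda>u. f u * c)"
  and lin_times_right [linear_intros]: "linmap U H f \<Longrightarrow> linmap U H (\<lambda>u. c * f u)"
  by (auto simp: linmap_def algebra_simps scale_mult_left scale_mult_right)

lemma comult_in_HH [simp]: "comult H h \<in> vcarrier HH"
  using linmapD(1)[OF comult_linear] by simp

lemma lin_scaleH [linear_intros]: "linmap U scalars f \<Longrightarrow> linmap U H (\<lambda>u. vscale H (f u) c)"
  and lin_scaleH' [linear_intros]: "linmap U H g \<Longrightarrow> linmap U H (\<lambda>u. vscale H d (g u))"
proof -
  interpret vector_space "vscale H" by (rule vector_space)
  show "linmap U scalars f \<Longrightarrow> linmap U H (\<lambda>u. vscale H (f u) c)"
    and "linmap U H g \<Longrightarrow> linmap U H (\<lambda>u. vscale H d (g u))"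
    by (auto simp: linmap_def algebra_simps)
qed

lemma bilinear_flip: "bilinear_on H H HH (\<lambda>a b. b \<otimes>\<^bsub>H,H\<^esub> a)"
  by (auto intro!: bilinear_onI linear_intros)

lemma tflip_in [simp]: "t \<in> vcarrier HH \<Longrightarrow> tflip H t \<in> vcarrier HH"
  unfolding tflip_def by (rule sweedler_in[OF _ vspaces(3) bilinear_flip])

lemma linmap_tflip: "linmap HH HH (tflip H)"
  unfolding tflip_def by (rule linmap_sweedler[OF vspaces(1,1,3) bilinear_flip])

lemma bilin_flip: "bilin \<beta> \<Longrightarrow> bilin (\<lambda>a b. \<beta> b a)"
  by (simp add: bilinear_on_def)

lemma eval_tflip: "t \<in> vcarrier HH \<Longrightarrow> bilin \<beta> \<Longrightarrow> tflip H t \<beta> = t (\<lambda>a b. \<beta> b a)"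
  unfolding tflip_def by (simp add: eval_sweedler[OF _ bilinear_flip] eval_tensor)

lemma tflip_tflip: "t \<in> vcarrier HH \<Longrightarrow> tflip H (tflip H t) = t"
  by (rule tensor_eqI_HH) (simp_all add: eval_tflip bilin_flip)

lemma tmult_bilinear:
  "t \<in> vcarrier HH \<Longrightarrow>
    bilinear_on H H HH (\<lambda>a b. sweedler H H t (\<lambda>c d. (a * c) \<otimes>\<^bsub>H,H\<^esub> (b * d)))"
  by (auto intro!: bilinear_onI linear_intros vspaces)

lemma tmult_in: "s \<in> vcarrier HH \<Longrightarrow> t \<in> vcarrier HH \<Longrightarrow> tmult H s t \<in> vcarrier HH"
  unfolding tmult_def by (rule sweedler_in[OF _ vspaces(3) tmult_bilinear])

lemma eval_tmult:
  assumes s: "s \<in> vcarrier HH" and t: "t \<in> vcarrier HH" and b: "bilin \<beta>"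
  shows "tmult H s t \<beta> = s (\<lambda>a b. t (\<lambda>c d. \<beta> (a * c) (b * d)))"
proof -
  have 1: "bilinear_on H H HH (\<lambda>c d. (x * c) \<otimes>\<^bsub>H,H\<^esub> (y * d))" for x y
    by (auto intro!: bilinear_onI linear_intros)
  show ?thesis
    unfolding tmult_def
    by (simp add: eval_sweedler[OF s tmult_bilinear[OF t]] eval_sweedler[OF t 1] eval_tensor[OF b])
qed

sublocale left: bialgebra_structure H "(*)" 1 "comult H" "counit H"
proof
  show "bilinear_on H H H (*)" by (auto intro!: bilinear_onI linear_intros)
  show "comult H (g * h) \<beta> = comult H g (\<lambda>a b. comult H h (\<lambda>c d. \<beta> (a * c) (b * d)))"
    if "bilin \<beta>" for g h \<beta>
    by (simp add: comult_mult eval_tmult that)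
qed (simp_all add: mult.assoc comult_linear counit_linear comult_one eval_tensor counit_mult counit_one)

sublocale right: bialgebra_structure H "\<lambda>a b. b * a" 1 "\<lambda>h. tflip H (comult H h)" "counit H"
proof
  show "bilinear_on H H H (\<lambda>a b. b * a)" by (auto intro!: bilinear_onI linear_intros)
  show "linmap H HH (\<lambda>h. tflip H (comult H h))"
    by (rule linmap_comp[OF linmap_tflip comult_linear])
  show "tflip H (comult H 1) \<beta> = \<beta> 1 1" if "bilin \<beta>" for \<beta>
    by (simp add: comult_one eval_tflip eval_tensor bilin_flip that tensor_in_tensor_space)
  show "tflip H (comult H (h * g)) \<beta>
      = tflip H (comult H g) (\<lambda>a b. tflip H (comult H h) (\<lambda>c d. \<beta> (c * a) (d * b)))"
    if b: "bilin \<beta>" for g h \<beta>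
  proof -
    note [intro!] = bilin_arg1[OF b] bilin_arg2[OF b] bilinI linear_intros vspaces
    have 1: "bilin (\<lambda>c d. \<beta> (c * x) (d * y))" for x y by auto
    have 2: "bilin (\<lambda>x y. comult H h (\<lambda>c d. \<beta> (d * x) (c * y)))" by auto
    have "tflip H (comult H (h * g)) \<beta>
        = comult H h (\<lambda>a b. comult H g (\<lambda>c d. \<beta> (b * d) (a * c)))"
      by (simp add: eval_tflip b comult_mult eval_tmult bilin_flip tmult_in)
    also have "\<dots> = comult H g (\<lambda>c d. comult H h (\<lambda>a b. \<beta> (b * d) (a * c)))"
      by (rule eval_swap) auto
    also have "\<dots> = tflip H (comult H g) (\<lambda>a b. tflip H (comult H h) (\<lambda>c d. \<beta> (c * a) (d * b)))"
      by (simp add: eval_tflip[OF comult_in_HH 1] eval_tflip[OF comult_in_HH 2])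
    finally show ?thesis .
  qed
qed (simp_all add: mult.assoc counit_linear counit_mult counit_one)

lemma triangular_form_left_of_right:
  assumes "right.triangular_form Q"
  shows "left.triangular_form Q"
proof -
  have Q [simp]: "Q \<in> vcarrier HH"
    and nat: "\<And>h \<beta>. bilin \<beta> \<Longrightarrow> tflip H (comult H h) (\<lambda>h1 h2. Q (\<lambda>a b. \<beta> (h2 * a) (h1 * b)))
        = tflip H (comult H h) (\<lambda>h1 h2. Q (\<lambda>a b. \<beta> (a * h1) (b * h2)))"
    and inv: "\<And>\<beta>. bilin \<beta> \<Longrightarrow> Q (\<lambda>a b. Q (\<lambda>c d. \<beta> (b * c) (a * d))) = \<beta> 1 1"
    and inv': "\<And>\<beta>. bilin \<beta> \<Longrightarrow> Q (\<lambda>a b. Q (\<lambda>c d. \<beta> (c * b) (d * a))) = \<beta> 1 1"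
    and hex1: "\<And>\<tau>. trilin \<tau> \<Longrightarrow> Q (\<lambda>a b. tflip H (comult H a) (\<lambda>a1 a2. \<tau> a1 a2 b))
        = Q (\<lambda>a b. Q (\<lambda>c d. \<tau> a c (b * d)))"
    and hex2: "\<And>\<tau>. trilin \<tau> \<Longrightarrow> Q (\<lambda>a b. tflip H (comult H b) (\<lambda>b1 b2. \<tau> a b1 b2))
        = Q (\<lambda>a b. Q (\<lambda>c d. \<tau> (c * a) b d))"
    and cou: "\<And>f. lin f \<Longrightarrow> Q (\<lambda>a b. counit H a * f b) = f 1"
      "\<And>f. lin f \<Longrightarrow> Q (\<lambda>a b. counit H b * f a) = f 1"
    using assms unfolding right.triangular_form_def by simp_all
  note [intro!] = bilinI linear_intros lin_eval_param[OF Q] vspaces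
  have "comult H h (\<lambda>h1 h2. Q (\<lambda>a b. \<beta> (a * h2) (b * h1)))
      = comult H h (\<lambda>h1 h2. Q (\<lambda>a b. \<beta> (h1 * a) (h2 * b)))" if b: "bilin \<beta>" for h \<beta>
  proof -
    note [intro!] = bilin_arg1[OF b] bilin_arg2[OF b]
    have 1: "bilin (\<lambda>h1 h2. Q (\<lambda>a b. \<beta> (h2 * a) (h1 * b)))" by auto
    have 2: "bilin (\<lambda>h1 h2. Q (\<lambda>a b. \<beta> (a * h1) (b * h2)))" by auto
    show ?thesis
      using nat[OF b, of h] by (simp add: eval_tflip[OF _ 1] eval_tflip[OF _ 2])
  qed
  moreover have "Q (\<lambda>a b. comult H a (\<lambda>a1 a2. \<tau> a1 a2 b)) = Q (\<lambda>a b. Q (\<lambda>c d. \<tau> a c (d * b)))"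
    and "Q (\<lambda>a b. comult H b (\<lambda>b1 b2. \<tau> a b1 b2)) = Q (\<lambda>a b. Q (\<lambda>c d. \<tau> (a * c) b d))"
    if t: "trilin \<tau>" for \<tau>
  proof -
    note [intro!] = trilin_arg1[OF t] trilin_arg2[OF t] trilin_arg3[OF t]
    have t1: "trilin (\<lambda>a b c. \<tau> b a c)" and t2: "trilin (\<lambda>a b c. \<tau> a c b)"
      by (auto simp: trilin_def)
    have b1: "bilin (\<lambda>a1 a2. \<tau> a2 a1 b)" and b2: "bilin (\<lambda>a1 a2. \<tau> b a2 a1)" for b by auto
    have "Q (\<lambda>a b. comult H a (\<lambda>a1 a2. \<tau> a1 a2 b)) = Q (\<lambda>a b. Q (\<lambda>c d. \<tau> c a (b * d)))"
      using hex1[OF t1] by (simp add: eval_tflip[OF _ b1])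
    also have "\<dots> = Q (\<lambda>c d. Q (\<lambda>a b. \<tau> c a (b * d)))"
      by (rule eval_swap[OF Q Q]) auto
    finally show "Q (\<lambda>a b. comult H a (\<lambda>a1 a2. \<tau> a1 a2 b)) = Q (\<lambda>a b. Q (\<lambda>c d. \<tau> a c (d * b)))" .
    have "Q (\<lambda>a b. comult H b (\<lambda>b1 b2. \<tau> a b1 b2)) = Q (\<lambda>a b. Q (\<lambda>c d. \<tau> (c * a) d b))"
      using hex2[OF t2] by (simp add: eval_tflip[OF _ b2])
    also have "\<dots> = Q (\<lambda>c d. Q (\<lambda>a b. \<tau> (c * a) d b))"
      by (rule eval_swap[OF Q Q]) auto
    finally show "Q (\<lambda>a b. comult H b (\<lambda>b1 b2. \<tau> a b1 b2)) = Q (\<lambda>a b. Q (\<lambda>c d. \<tau> (a * c) b d))" .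
  qed
  ultimately show ?thesis
    unfolding left.triangular_form_def using inv inv' cou by simp
qed

lemma eq_of_functionals:
  assumes "\<And>f. lin f \<Longrightarrow> f x = f y"
  shows "x = y"
proof (rule ccontr)
  assume "x \<noteq> y"
  then obtain f where f: "Vector_Spaces.linear (vscale H) (*) f" "f (x - y) \<noteq> 0"
    using exists_functional[OF vector_space, of "x - y"] by auto
  then have "lin f" by (auto simp: linmap_def Vector_Spaces.linear_iff)
  from assms[OF this] f linmapD(2)[OF this, of "x - y" y] show False by simp
qed

text \<open>A linear functional on \<open>H \<otimes> H\<close> is evaluation at its restriction to pure tensors.\<close>

lemma linear_eval_tensor:
  assumes g: "linmap HH scalars g" and s: "s \<in> vcarrier HH"
  shows "g s = s (\<lambda>x y. g (x \<otimes>\<^bsub>H,H\<^esub> y))"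
proof (rule linmap_tensor_space_eqI[OF vspaces(1) g linmap_eval _ s])
  have "bilin (\<lambda>x y. g (x \<otimes>\<^bsub>H,H\<^esub> y))"
    by (auto intro!: bilinI linmap_comp[OF g] linear_intros)
  then show "g (v \<otimes>\<^bsub>H,H\<^esub> w) = (v \<otimes>\<^bsub>H,H\<^esub> w) (\<lambda>x y. g (x \<otimes>\<^bsub>H,H\<^esub> y))" for v w
    by (simp add: eval_tensor)
qed

lemma triangular_of_triangular_form:
  assumes "left.triangular_form Q"
  shows "triangular H (tflip H Q)"
proof -
  have Q [simp]: "Q \<in> vcarrier HH"
    and nat: "\<And>h \<beta>. bilin \<beta> \<Longrightarrow> comult H h (\<lambda>h1 h2. Q (\<lambda>a b. \<beta> (a * h2) (b * h1)))
        = comult H h (\<lambda>h1 h2. Q (\<lambda>a b. \<beta> (h1 * a) (h2 * b)))"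
    and inv: "\<And>\<beta>. bilin \<beta> \<Longrightarrow> Q (\<lambda>a b. Q (\<lambda>c d. \<beta> (b * c) (a * d))) = \<beta> 1 1"
    and hex1: "\<And>\<tau>. trilin \<tau> \<Longrightarrow> Q (\<lambda>a b. comult H a (\<lambda>a1 a2. \<tau> a1 a2 b))
        = Q (\<lambda>a b. Q (\<lambda>c d. \<tau> a c (d * b)))"
    and hex2: "\<And>\<tau>. trilin \<tau> \<Longrightarrow> Q (\<lambda>a b. comult H b (\<lambda>b1 b2. \<tau> a b1 b2))
        = Q (\<lambda>a b. Q (\<lambda>c d. \<tau> (a * c) b d))"
    and cou: "\<And>f. lin f \<Longrightarrow> Q (\<lambda>a b. counit H a * f b) = f 1"
      "\<And>f. lin f \<Longrightarrow> Q (\<lambda>a b. counit H b * f a) = f 1"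
    using assms unfolding left.triangular_form_def by simp_all
  let ?R = "tflip H Q"
  have R: "?R \<in> vcarrier HH" by simp
  note [intro!] = bilinI linear_intros lin_eval_param[OF Q] lin_eval_param[OF R] vspaces
  have 1: "tmult H ?R Q = (1 \<otimes>\<^bsub>H,H\<^esub> 1)"
  proof (rule tensor_eqI_HH)
    fix \<beta> assume b: "bilin \<beta>"
    note [intro!] = bilin_arg1[OF b] bilin_arg2[OF b]
    have "bilin (\<lambda>a b. Q (\<lambda>c d. \<beta> (a * c) (b * d)))" by auto
    then show "tmult H ?R Q \<beta> = (1 \<otimes>\<^bsub>H,H\<^esub> 1) \<beta>"
      by (simp add: eval_tmult b eval_tflip eval_tensor inv)
  qed (simp_all add: tmult_in tensor_in_tensor_space)
  have 2: "tmult H Q ?R = (1 \<otimes>\<^bsub>H,H\<^esub> 1)"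
  proof (rule tensor_eqI_HH)
    fix \<beta> assume b: "bilin \<beta>"
    note [intro!] = bilin_arg1[OF b] bilin_arg2[OF b]
    have "bilin (\<lambda>c d. \<beta> (x * c) (y * d))" for x y by auto
    then show "tmult H Q ?R \<beta> = (1 \<otimes>\<^bsub>H,H\<^esub> 1) \<beta>"
      using inv[OF bilin_flip[OF b]] by (simp add: eval_tmult b eval_tflip eval_tensor)
  qed (simp_all add: tmult_in tensor_in_tensor_space)
  have inverse: "is_tinverse H ?R Q"
    using 1 2 by (simp add: is_tinverse_def)
  have hex_a: "sweedler H H ?R (\<lambda>R1 R2. sweedler H H (comult H R1) (\<lambda>a b. a \<otimes>\<^bsub>H,HH\<^esub> (b \<otimes>\<^bsub>H,H\<^esub> R2)))
      = sweedler H H ?R (\<lambda>R1 R2. sweedler H H ?R (\<lambda>r1 r2. R1 \<otimes>\<^bsub>H,HH\<^esub> (r1 \<otimes>\<^bsub>H,H\<^esub> (R2 * r2))))"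
    (is "?l = ?r")
  proof (rule tensor_eqI[OF vspaces(1)])
    have l1: "bilinear_on H H (H \<otimes>\<^sub>V HH) (\<lambda>a b. a \<otimes>\<^bsub>H,HH\<^esub> (b \<otimes>\<^bsub>H,H\<^esub> y))" for y
      by (auto intro!: bilinear_onI tensor_in_tensor_space)
    have l2: "bilinear_on H H (H \<otimes>\<^sub>V HH)
        (\<lambda>R1 R2. sweedler H H (comult H R1) (\<lambda>a b. a \<otimes>\<^bsub>H,HH\<^esub> (b \<otimes>\<^bsub>H,H\<^esub> R2)))"
      by (auto intro!: bilinear_onI l1 tensor_in_tensor_space)
    have r1: "bilinear_on H H (H \<otimes>\<^sub>V HH) (\<lambda>r1 r2. x \<otimes>\<^bsub>H,HH\<^esub> (r1 \<otimes>\<^bsub>H,H\<^esub> (y * r2)))" for x y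
      by (auto intro!: bilinear_onI tensor_in_tensor_space)
    have r2: "bilinear_on H H (H \<otimes>\<^sub>V HH)
        (\<lambda>R1 R2. sweedler H H ?R (\<lambda>r1 r2. R1 \<otimes>\<^bsub>H,HH\<^esub> (r1 \<otimes>\<^bsub>H,H\<^esub> (R2 * r2))))"
      by (auto intro!: bilinear_onI r1 tensor_in_tensor_space R)
    show "?l \<in> vcarrier (H \<otimes>\<^sub>V HH)" "?r \<in> vcarrier (H \<otimes>\<^sub>V HH)"
      by (rule sweedler_in[OF R vspaces(3)] l2 r2)+
    fix B :: "'h \<Rightarrow> ('k, 'h, 'h) tensor \<Rightarrow> 'k" assume "bilinear_form H HH B"
    define \<tau> where "\<tau> a b c = (a \<otimes>\<^bsub>H,HH\<^esub> (b \<otimes>\<^bsub>H,H\<^esub> c)) B" for a b c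
    have t: "trilin \<tau>"
      unfolding trilin_def \<tau>_def by (auto intro!: tensor_in_tensor_space)
    note [intro!] = trilin_arg1[OF t] trilin_arg2[OF t] trilin_arg3[OF t]
    have l: "?l B = ?R (\<lambda>R1 R2. comult H R1 (\<lambda>a b. \<tau> a b R2))"
      by (simp add: eval_sweedler[OF R l2] eval_sweedler[OF comult_in_HH l1] \<tau>_def)
    have r: "?r B = ?R (\<lambda>R1 R2. ?R (\<lambda>r1 r2. \<tau> R1 r1 (R2 * r2)))"
      by (simp add: eval_sweedler[OF R r2] eval_sweedler[OF R r1] \<tau>_def)
    have t': "trilin (\<lambda>a b c. \<tau> b c a)"
      by (auto simp: trilin_def)
    have b: "bilin (\<lambda>R1 R2. comult H R1 (\<lambda>a b. \<tau> a b R2))"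
      "bilin (\<lambda>R1 R2. Q (\<lambda>r2 r1. \<tau> R1 r1 (R2 * r2)))" "bilin (\<lambda>r1 r2. \<tau> x r1 (y * r2))" for x y
      by auto
    show "?l B = ?r B"
      using hex2[OF t'] by (simp add: l r eval_tflip[OF Q b(1)] eval_tflip[OF Q b(2)] eval_tflip[OF Q b(3)])
  qed
  have hex_b: "sweedler H H ?R (\<lambda>R1 R2. R1 \<otimes>\<^bsub>H,HH\<^esub> comult H R2)
      = sweedler H H ?R (\<lambda>R1 R2. sweedler H H ?R (\<lambda>r1 r2. (R1 * r1) \<otimes>\<^bsub>H,HH\<^esub> (r2 \<otimes>\<^bsub>H,H\<^esub> R2)))"
    (is "?l = ?r")
  proof (rule tensor_eqI[OF vspaces(1)])
    have l1: "bilinear_on H H (H \<otimes>\<^sub>V HH) (\<lambda>R1 R2. R1 \<otimes>\<^bsub>H,HH\<^esub> comult H R2)"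
      by (auto intro!: bilinear_onI)
    have r1: "bilinear_on H H (H \<otimes>\<^sub>V HH) (\<lambda>r1 r2. (x * r1) \<otimes>\<^bsub>H,HH\<^esub> (r2 \<otimes>\<^bsub>H,H\<^esub> y))" for x y
      by (auto intro!: bilinear_onI tensor_in_tensor_space)
    have r2: "bilinear_on H H (H \<otimes>\<^sub>V HH)
        (\<lambda>R1 R2. sweedler H H ?R (\<lambda>r1 r2. (R1 * r1) \<otimes>\<^bsub>H,HH\<^esub> (r2 \<otimes>\<^bsub>H,H\<^esub> R2)))"
      by (auto intro!: bilinear_onI r1 tensor_in_tensor_space R)
    show "?l \<in> vcarrier (H \<otimes>\<^sub>V HH)" "?r \<in> vcarrier (H \<otimes>\<^sub>V HH)"
      by (rule sweedler_in[OF R vspaces(3)] l1 r2)+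
    fix B :: "'h \<Rightarrow> ('k, 'h, 'h) tensor \<Rightarrow> 'k" assume "bilinear_form H HH B"
    define \<tau> where "\<tau> a b c = (a \<otimes>\<^bsub>H,HH\<^esub> (b \<otimes>\<^bsub>H,H\<^esub> c)) B" for a b c
    have t: "trilin \<tau>"
      unfolding trilin_def \<tau>_def by (auto intro!: tensor_in_tensor_space)
    note [intro!] = trilin_arg1[OF t] trilin_arg2[OF t] trilin_arg3[OF t]
    have "(x \<otimes>\<^bsub>H,HH\<^esub> comult H y) B = comult H y (\<lambda>b c. \<tau> x b c)" for x y
      unfolding \<tau>_def by (rule linear_eval_tensor) auto
    then have l: "?l B = ?R (\<lambda>R1 R2. comult H R2 (\<lambda>b c. \<tau> R1 b c))"
      by (simp add: eval_sweedler[OF R l1])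
    have r: "?r B = ?R (\<lambda>R1 R2. ?R (\<lambda>r1 r2. \<tau> (R1 * r1) r2 R2))"
      by (simp add: eval_sweedler[OF R r2] eval_sweedler[OF R r1] \<tau>_def)
    have t': "trilin (\<lambda>a b c. \<tau> c a b)"
      by (auto simp: trilin_def)
    have b: "bilin (\<lambda>R1 R2. comult H R2 (\<lambda>b c. \<tau> R1 b c))"
      "bilin (\<lambda>R1 R2. Q (\<lambda>r2 r1. \<tau> (R1 * r1) r2 R2))" "bilin (\<lambda>r1 r2. \<tau> (x * r1) r2 y)" for x y
      by auto
    have "Q (\<lambda>a b. Q (\<lambda>c d. \<tau> (d * b) a c)) = Q (\<lambda>c d. Q (\<lambda>a b. \<tau> (d * b) a c))"
      by (rule eval_swap[OF Q Q]) auto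
    then show "?l B = ?r B"
      using hex1[OF t'] by (simp add: l r eval_tflip[OF Q b(1)] eval_tflip[OF Q b(2)] eval_tflip[OF Q b(3)])
  qed
  have cop: "tmult H (tflip H (comult H h)) ?R = tmult H ?R (comult H h)" for h
  proof (rule tensor_eqI_HH)
    fix \<beta> assume b: "bilin \<beta>"
    note [intro!] = bilin_arg1[OF b] bilin_arg2[OF b]
    have 1: "bilin (\<lambda>c d. \<beta> (x * c) (y * d))" "bilin (\<lambda>a b. Q (\<lambda>c d. \<beta> (a * d) (b * c)))"
      "bilin (\<lambda>a b. comult H h (\<lambda>c d. \<beta> (a * c) (b * d)))" for x y by auto
    have "tmult H (tflip H (comult H h)) ?R \<beta> = comult H h (\<lambda>h1 h2. Q (\<lambda>a b. \<beta> (h2 * b) (h1 * a)))"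
      by (simp add: eval_tmult b eval_tflip 1)
    also have "\<dots> = comult H h (\<lambda>h1 h2. Q (\<lambda>a b. \<beta> (b * h1) (a * h2)))"
      using nat[OF bilin_flip[OF b]] by simp
    also have "\<dots> = Q (\<lambda>a b. comult H h (\<lambda>h1 h2. \<beta> (b * h1) (a * h2)))"
      by (rule eval_swap[OF comult_in_HH Q]) auto
    also have "\<dots> = tmult H ?R (comult H h) \<beta>"
      by (simp add: eval_tmult b eval_tflip 1)
    finally show "tmult H (tflip H (comult H h)) ?R \<beta> = tmult H ?R (comult H h) \<beta>" .
  qed (simp_all add: tmult_in)
  have cou_a: "sweedler H H ?R (\<lambda>R1 R2. vscale H (counit H R1) R2) = 1"
  proof (rule eq_of_functionals)
    fix f assume f: "lin f"
    have 1: "bilinear_on H H H (\<lambda>R1 R2. vscale H (counit H R1) R2)" by (auto intro!: bilinear_onI)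
    have 2: "bilin (\<lambda>R1 R2. counit H R1 * f R2)" by (auto intro!: lin_arg[OF f])
    show "f (sweedler H H ?R (\<lambda>R1 R2. vscale H (counit H R1) R2)) = f 1"
      using cou(2)[OF f] by (simp add: eval_linmap_sweedler[OF R vspaces(1) 1 f] linmapD(3)[OF f] eval_tflip[OF Q 2])
  qed
  have cou_b: "sweedler H H ?R (\<lambda>R1 R2. vscale H (counit H R2) R1) = 1"
  proof (rule eq_of_functionals)
    fix f assume f: "lin f"
    have 1: "bilinear_on H H H (\<lambda>R1 R2. vscale H (counit H R2) R1)" by (auto intro!: bilinear_onI)
    have 2: "bilin (\<lambda>R1 R2. counit H R2 * f R1)" by (auto intro!: lin_arg[OF f])
    show "f (sweedler H H ?R (\<lambda>R1 R2. vscale H (counit H R2) R1)) = f 1"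
      using cou(1)[OF f] by (simp add: eval_linmap_sweedler[OF R vspaces(1) 1 f] linmapD(3)[OF f] eval_tflip[OF Q 2])
  qed
  show ?thesis
    unfolding triangular_def quasitriangular_def
    using hopf_algebra_axioms R inverse hex_a hex_b cop cou_a cou_b
    by (auto simp: tflip_tflip[OF Q])
qed

end


section \<open>The braiding of the tensor square\<close>

text \<open>
  Only linearity of \<open>\<rho>1\<close> and \<open>\<rho>2\<close> is assumed here; the comodule and Yetter-Drinfel'd
  axioms are hypotheses of the lemmas that use them.
\<close>

locale tensor_square_coactions = hopf_algebra H
  for H :: "('k::field, 'h::ring_1, 'z) hopf_scheme" +
  fixes \<rho>1 \<rho>2 :: "'h \<Rightarrow> ('k, 'h, 'h) tensor"
  assumes linmap_\<rho>1: "linmap H (H \<otimes>\<^sub>V H) \<rho>1" and linmap_\<rho>2: "linmap H (H \<otimes>\<^sub>V H) \<rho>2"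
begin

abbreviation "M \<equiv> tensor_square H \<rho>1 \<rho>2"

lemma M_space [simp]: "vcarrier M = vcarrier HH" "vscale M = tscale"
  by (simp_all add: tensor_square_def)

lemma M_tensor [simp]:
  "(u \<otimes>\<^bsub>M,M\<^esub> v) = (u \<otimes>\<^bsub>HH,HH\<^esub> v)" "(h \<otimes>\<^bsub>H,M\<^esub> v) = (h \<otimes>\<^bsub>H,HH\<^esub> v)" "(v \<otimes>\<^bsub>M,H\<^esub> h) = (v \<otimes>\<^bsub>HH,H\<^esub> h)"
  "M \<otimes>\<^sub>V M = HH \<otimes>\<^sub>V HH" "H \<otimes>\<^sub>V M = H \<otimes>\<^sub>V HH" "M \<otimes>\<^sub>V H = HH \<otimes>\<^sub>V H"
  "sweedler M M = sweedler HH HH" "sweedler H M = sweedler H HH" "sweedler M H = sweedler HH H"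
  by (rule same_space; simp)+

lemma \<rho>1_in [simp]: "\<rho>1 k \<in> vcarrier HH" and \<rho>2_in [simp]: "\<rho>2 k \<in> vcarrier HH"
  using linmapD(1)[OF linmap_\<rho>1] linmapD(1)[OF linmap_\<rho>2] by simp_all

lemma lin_\<rho>1 [linear_intros]: "linmap U H f \<Longrightarrow> linmap U HH (\<lambda>u. \<rho>1 (f u))"
  and lin_\<rho>2 [linear_intros]: "linmap U H f \<Longrightarrow> linmap U HH (\<lambda>u. \<rho>2 (f u))"
  by (rule linmap_comp[OF linmap_\<rho>1], assumption) (rule linmap_comp[OF linmap_\<rho>2])

lemmas lin_\<rho>_eval [linear_intros] = lin_eval[OF lin_\<rho>1] lin_eval[OF lin_\<rho>2]

lemmas lin_\<rho>_param [linear_intros] = lin_eval_param[OF \<rho>1_in] lin_eval_param[OF \<rho>2_in]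

lemma act_bilinear:
  "bilinear_on H H HH (\<lambda>k l. (h * k) \<otimes>\<^bsub>H,H\<^esub> l)" "bilinear_on H H HH (\<lambda>k l. k \<otimes>\<^bsub>H,H\<^esub> (l * h))"
  by (auto intro!: bilinear_onI linear_intros)

lemma lact_tensor [simp]: "lact M h (k \<otimes>\<^bsub>H,H\<^esub> l) = ((h * k) \<otimes>\<^bsub>H,H\<^esub> l)"
  and ract_tensor [simp]: "ract M (k \<otimes>\<^bsub>H,H\<^esub> l) h = (k \<otimes>\<^bsub>H,H\<^esub> (l * h))"
  by (simp_all add: tensor_square_def sweedler_tensor[OF vspaces(1,1,3) act_bilinear(1)]
      sweedler_tensor[OF vspaces(1,1,3) act_bilinear(2)])

lemma lin_act [linear_intros]:
  "linmap U HH f \<Longrightarrow> linmap U HH (\<lambda>u. lact M h (f u))"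
  "linmap U HH f \<Longrightarrow> linmap U HH (\<lambda>u. ract M (f u) h)"
  by (auto simp: tensor_square_def act_bilinear intro!: lin_sweedler vspaces)

lemma lin_act' [linear_intros]:
  "is_vspace U \<Longrightarrow> linmap U H g \<Longrightarrow> m \<in> vcarrier HH \<Longrightarrow> linmap U HH (\<lambda>u. lact M (g u) m)"
  "is_vspace U \<Longrightarrow> linmap U H g \<Longrightarrow> m \<in> vcarrier HH \<Longrightarrow> linmap U HH (\<lambda>u. ract M m (g u))"
  by (auto simp: tensor_square_def act_bilinear intro!: lin_sweedler_param vspaces linear_intros)

lemma act_in [simp]:
  "m \<in> vcarrier HH \<Longrightarrow> lact M h m \<in> vcarrier HH" "m \<in> vcarrier HH \<Longrightarrow> ract M m h \<in> vcarrier HH"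
  by (auto intro: linmapD(1)[OF lin_act(1)[OF lin_id]] linmapD(1)[OF lin_act(2)[OF lin_id]])

lemma coact_bilinear_inner:
  "bilinear_on H H (H \<otimes>\<^sub>V HH) (\<lambda>a k0. a \<otimes>\<^bsub>H,HH\<^esub> (k0 \<otimes>\<^bsub>H,H\<^esub> l))"
  "bilinear_on H H (HH \<otimes>\<^sub>V H) (\<lambda>l0 b. (k \<otimes>\<^bsub>H,H\<^esub> l0) \<otimes>\<^bsub>HH,H\<^esub> b)"
  by (auto intro!: bilinear_onI linear_intros tensor_in_tensor_space)

lemma coact_bilinear:
  "bilinear_on H H (H \<otimes>\<^sub>V HH) (\<lambda>k l. sweedler H H (\<rho>1 k) (\<lambda>a k0. a \<otimes>\<^bsub>H,HH\<^esub> (k0 \<otimes>\<^bsub>H,H\<^esub> l)))"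
  "bilinear_on H H (HH \<otimes>\<^sub>V H) (\<lambda>k l. sweedler H H (\<rho>2 l) (\<lambda>l0 b. (k \<otimes>\<^bsub>H,H\<^esub> l0) \<otimes>\<^bsub>HH,H\<^esub> b))"
  by (auto intro!: bilinear_onI[where V = H and W = H] coact_bilinear_inner vspaces linear_intros tensor_in_tensor_space)

lemma lcoact_tensor:
  "lcoact M (k \<otimes>\<^bsub>H,H\<^esub> l) = sweedler H H (\<rho>1 k) (\<lambda>a k0. a \<otimes>\<^bsub>H,HH\<^esub> (k0 \<otimes>\<^bsub>H,H\<^esub> l))"
  and rcoact_tensor:
  "rcoact M (k \<otimes>\<^bsub>H,H\<^esub> l) = sweedler H H (\<rho>2 l) (\<lambda>l0 b. (k \<otimes>\<^bsub>H,H\<^esub> l0) \<otimes>\<^bsub>HH,H\<^esub> b)"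
  by (simp_all add: tensor_square_def sweedler_tensor[OF vspaces(1,1,3) coact_bilinear(1)]
      sweedler_tensor[OF vspaces(1,1,3) coact_bilinear(2)])

lemma lin_lcoact [linear_intros]: "linmap U HH f \<Longrightarrow> linmap U (H \<otimes>\<^sub>V HH) (\<lambda>u. lcoact M (f u))"
  and lin_rcoact [linear_intros]: "linmap U HH f \<Longrightarrow> linmap U (HH \<otimes>\<^sub>V H) (\<lambda>u. rcoact M (f u))"
  by (auto simp: tensor_square_def coact_bilinear intro!: lin_sweedler vspaces)

lemma coact_in [simp]:
  "m \<in> vcarrier HH \<Longrightarrow> lcoact M m \<in> vcarrier (H \<otimes>\<^sub>V HH)"
  "m \<in> vcarrier HH \<Longrightarrow> rcoact M m \<in> vcarrier (HH \<otimes>\<^sub>V H)"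
  by (auto intro: linmapD(1)[OF lin_lcoact[OF lin_id]] linmapD(1)[OF lin_rcoact[OF lin_id]])

lemma linmap_lcoact:
  "linmap (H \<otimes>\<^sub>V HH) scalars g \<Longrightarrow>
    g (lcoact M (k \<otimes>\<^bsub>H,H\<^esub> l)) = \<rho>1 k (\<lambda>a k0. g (a \<otimes>\<^bsub>H,HH\<^esub> (k0 \<otimes>\<^bsub>H,H\<^esub> l)))"
  unfolding lcoact_tensor by (rule eval_linmap_sweedler[OF \<rho>1_in vspaces(3) coact_bilinear_inner(1)])

lemma linmap_rcoact:
  "linmap (HH \<otimes>\<^sub>V H) scalars g \<Longrightarrow>
    g (rcoact M (k \<otimes>\<^bsub>H,H\<^esub> l)) = \<rho>2 l (\<lambda>l0 b. g ((k \<otimes>\<^bsub>H,H\<^esub> l0) \<otimes>\<^bsub>HH,H\<^esub> b))"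
  unfolding rcoact_tensor by (rule eval_linmap_sweedler[OF \<rho>2_in vspaces(3) coact_bilinear_inner(2)])

lemma braiding_bilinear:
  "bilinear_on HH H (HH \<otimes>\<^sub>V HH) (\<lambda>n0 b. lact M a n0 \<otimes>\<^bsub>HH,HH\<^esub> ract M m0 b)"
  if "m0 \<in> vcarrier HH" for a m0
  using that by (auto intro!: bilinear_onI[where V = HH and W = H] vspaces linear_intros)

lemma braiding_bilinear':
  assumes "n \<in> vcarrier HH"
  shows "bilinear_on H HH (HH \<otimes>\<^sub>V HH)
    (\<lambda>a m0. sweedler HH H (rcoact M n) (\<lambda>n0 b. lact M a n0 \<otimes>\<^bsub>HH,HH\<^esub> ract M m0 b))"
  using assms
  by (auto intro!: bilinear_onI[where V = H and W = HH] braiding_bilinear vspaces linear_intros)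

lemma braiding_bilinear'':
  "bilinear_on HH HH (HH \<otimes>\<^sub>V HH)
    (\<lambda>m n. sweedler H HH (lcoact M m) (\<lambda>a m0. sweedler HH H (rcoact M n)
      (\<lambda>n0 b. lact M a n0 \<otimes>\<^bsub>HH,HH\<^esub> ract M m0 b)))"
  by (auto intro!: bilinear_onI[where V = HH and W = HH] braiding_bilinear braiding_bilinear' vspaces linear_intros)

lemma braiding_eq: "braiding H M M t = sweedler HH HH t
    (\<lambda>m n. sweedler H HH (lcoact M m) (\<lambda>a m0. sweedler HH H (rcoact M n)
      (\<lambda>n0 b. lact M a n0 \<otimes>\<^bsub>HH,HH\<^esub> ract M m0 b)))"
  by (simp add: braiding_def)

lemma linmap_braiding: "linmap (HH \<otimes>\<^sub>V HH) (HH \<otimes>\<^sub>V HH) (braiding H M M)"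
  unfolding braiding_eq by (rule linmap_sweedler[OF vspaces(3,3,3) braiding_bilinear''])

text \<open>
  The braiding on pure tensors, tested against a linear functional:
  \<open>(k \<otimes> l) \<otimes> (k' \<otimes> l') \<mapsto> (k\<^sub>-\<^sub>1 k' \<otimes> l'\<^sub>0) \<otimes> (k\<^sub>0 \<otimes> l l'\<^sub>1)\<close>.
\<close>

lemma functional_braiding:
  assumes g: "linmap (HH \<otimes>\<^sub>V HH) scalars g"
  shows "g (braiding H M M ((k \<otimes>\<^bsub>H,H\<^esub> l) \<otimes>\<^bsub>HH,HH\<^esub> (k' \<otimes>\<^bsub>H,H\<^esub> l')))
    = \<rho>1 k (\<lambda>a k0. \<rho>2 l' (\<lambda>l0 b. g (((a * k') \<otimes>\<^bsub>H,H\<^esub> l0) \<otimes>\<^bsub>HH,HH\<^esub> (k0 \<otimes>\<^bsub>H,H\<^esub> (l * b)))))"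
proof -
  let ?n = "k' \<otimes>\<^bsub>H,H\<^esub> l'"
  let ?F = "\<lambda>a m0. sweedler HH H (rcoact M ?n) (\<lambda>n0 b. lact M a n0 \<otimes>\<^bsub>HH,HH\<^esub> ract M m0 b)"
  have n: "?n \<in> vcarrier HH" and t_in [simp]: "(x \<otimes>\<^bsub>H,H\<^esub> y) \<in> vcarrier HH" for x y
    by (simp_all add: tensor_in_tensor_space)
  have 1: "linmap (H \<otimes>\<^sub>V HH) scalars (\<lambda>s. g (sweedler H HH s ?F))"
    by (rule linmap_comp[OF g linmap_sweedler[OF vspaces(1,3,3) braiding_bilinear'[OF n]]])
  have 2: "linmap (HH \<otimes>\<^sub>V H) scalars
      (\<lambda>s. g (sweedler HH H s (\<lambda>n0 b. lact M a n0 \<otimes>\<^bsub>HH,HH\<^esub> ract M (k0 \<otimes>\<^bsub>H,H\<^esub> l) b)))" for a k0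
    by (rule linmap_comp[OF g linmap_sweedler[OF vspaces(3,1,3) braiding_bilinear[OF t_in]]])
  have "g (braiding H M M ((k \<otimes>\<^bsub>H,H\<^esub> l) \<otimes>\<^bsub>HH,HH\<^esub> ?n)) = g (sweedler H HH (lcoact M (k \<otimes>\<^bsub>H,H\<^esub> l)) ?F)"
    unfolding braiding_eq by (simp add: sweedler_tensor[OF vspaces(3,3,3) braiding_bilinear''])
  also have "\<dots> = \<rho>1 k (\<lambda>a k0. g (?F a (k0 \<otimes>\<^bsub>H,H\<^esub> l)))"
    unfolding linmap_lcoact[OF 1]
    by (simp add: sweedler_tensor[OF vspaces(1,3,3) braiding_bilinear'[OF n]])
  also have "\<dots> = \<rho>1 k (\<lambda>a k0. \<rho>2 l' (\<lambda>l0 b. g (((a * k') \<otimes>\<^bsub>H,H\<^esub> l0) \<otimes>\<^bsub>HH,HH\<^esub> (k0 \<otimes>\<^bsub>H,H\<^esub> (l * b)))))"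
    unfolding linmap_rcoact[OF 2] sweedler_tensor[OF vspaces(3,1,3) braiding_bilinear[OF t_in] t_in in_carrier]
    by simp
  finally show ?thesis .
qed

lemma functional_braiding_braiding:
  assumes g: "linmap (HH \<otimes>\<^sub>V HH) scalars g"
  shows "g (braiding H M M (braiding H M M ((k \<otimes>\<^bsub>H,H\<^esub> l) \<otimes>\<^bsub>HH,HH\<^esub> (k' \<otimes>\<^bsub>H,H\<^esub> l'))))
    = \<rho>1 k (\<lambda>a k0. \<rho>2 l' (\<lambda>l0 b. \<rho>1 (a * k') (\<lambda>a' k1. \<rho>2 (l * b) (\<lambda>l1 b'.
        g (((a' * k0) \<otimes>\<^bsub>H,H\<^esub> l1) \<otimes>\<^bsub>HH,HH\<^esub> (k1 \<otimes>\<^bsub>H,H\<^esub> (l0 * b')))))))"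
  unfolding functional_braiding[OF linmap_comp[OF g linmap_braiding]] functional_braiding[OF g] ..

text \<open>
  The next lemmas supply functionals on iterated tensor products with prescribed values on pure tensors.
  They are built by Sweedler sums because an expression like \<open>s (\<tau> a)\<close> is linear in \<open>a\<close> only for
  \<open>s\<close> in the carrier of \<open>H \<otimes> H\<close>, not for arbitrary functionals \<open>s\<close>.
\<close>

lemma product_functional:
  assumes \<beta>: "bilin \<beta>" and \<gamma>: "bilin \<gamma>"
  obtains g where "linmap (HH \<otimes>\<^sub>V HH) scalars g"
    and "\<And>x y x' y'. g ((x \<otimes>\<^bsub>H,H\<^esub> y) \<otimes>\<^bsub>HH,HH\<^esub> (x' \<otimes>\<^bsub>H,H\<^esub> y')) = \<beta> x x' * \<gamma> y y'"
proof -
  note [intro!] = bilinI linear_intros vspaces bilin_arg1[OF \<beta>] bilin_arg2[OF \<beta>]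
    bilin_arg1[OF \<gamma>] bilin_arg2[OF \<gamma>]
  let ?F = "\<lambda>m n. m (\<lambda>x y. n (\<lambda>x' y'. \<beta> x x' * \<gamma> y y'))"
  have 1: "bilin (\<lambda>x' y'. \<beta> x x' * \<gamma> y y')" for x y
    by auto
  have 2: "bilin (\<lambda>x y. n (\<lambda>x' y'. \<beta> x x' * \<gamma> y y'))" if "n \<in> vcarrier HH" for n
    by (intro bilinI lin_eval_param[OF that] vspaces 1 linear_intros bilin_arg1[OF \<beta>] bilin_arg1[OF \<gamma>])
  have F: "bilinear_on HH HH scalars ?F"
  proof (rule bilinear_onI)
    show "linmap HH scalars (\<lambda>m. ?F m n)" if "n \<in> vcarrier HH" for n by (rule linmap_eval)
    show "linmap HH scalars (\<lambda>n. ?F m n)" if "m \<in> vcarrier HH" for m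
      by (intro lin_eval_param[OF that] vspaces 2 linmap_eval)
  qed
  show ?thesis
  proof
    show "linmap (HH \<otimes>\<^sub>V HH) scalars (\<lambda>t. sweedler HH HH t ?F)"
      by (rule linmap_sweedler[OF vspaces(3,3,2) F])
    show "sweedler HH HH ((x \<otimes>\<^bsub>H,H\<^esub> y) \<otimes>\<^bsub>HH,HH\<^esub> (x' \<otimes>\<^bsub>H,H\<^esub> y')) ?F = \<beta> x x' * \<gamma> y y'" for x y x' y'
      using eval_tensor[OF 2, of "x' \<otimes>\<^bsub>H,H\<^esub> y'"]
      by (simp add: sweedler_tensor[OF vspaces(3,3,2) F] tensor_in_tensor_space eval_tensor[OF 1])
  qed
qed


lemma trilinear_functional_left:
  assumes \<tau>: "trilin \<tau>"
  obtains g where "linmap (H \<otimes>\<^sub>V HH) scalars g"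
    and "\<And>a s. s \<in> vcarrier HH \<Longrightarrow> g (a \<otimes>\<^bsub>H,HH\<^esub> s) = s (\<tau> a)"
    and "\<And>a b c. g (a \<otimes>\<^bsub>H,HH\<^esub> (b \<otimes>\<^bsub>H,H\<^esub> c)) = \<tau> a b c"
proof -
  have b: "bilin (\<tau> a)" for a using \<tau> by (simp add: trilin_def)
  have F: "bilinear_on H HH scalars (\<lambda>a s. s (\<tau> a))"
  proof (rule bilinear_onI)
    show "linmap H scalars (\<lambda>a. s (\<tau> a))" if "s \<in> vcarrier HH" for s
      by (intro lin_eval_param[OF that] vspaces b trilin_arg1[OF \<tau>] lin_id)
  qed (rule linmap_eval)
  show ?thesis
  proof
    show "linmap (H \<otimes>\<^sub>V HH) scalars (\<lambda>t. sweedler H HH t (\<lambda>a s. s (\<tau> a)))"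
      by (rule linmap_sweedler[OF vspaces(1,3,2) F])
    show *: "sweedler H HH (a \<otimes>\<^bsub>H,HH\<^esub> s) (\<lambda>a s. s (\<tau> a)) = s (\<tau> a)" if "s \<in> vcarrier HH" for a s
      using that by (simp add: sweedler_tensor[OF vspaces(1,3,2) F])
    show "sweedler H HH (a \<otimes>\<^bsub>H,HH\<^esub> (b \<otimes>\<^bsub>H,H\<^esub> c)) (\<lambda>a s. s (\<tau> a)) = \<tau> a b c" for a b c
      by (simp add: * tensor_in_tensor_space eval_tensor b)
  qed
qed

lemma trilinear_functional_right:
  assumes \<tau>: "trilin \<tau>"
  obtains g where "linmap (HH \<otimes>\<^sub>V H) scalars g"
    and "\<And>a b c. g ((a \<otimes>\<^bsub>H,H\<^esub> b) \<otimes>\<^bsub>HH,H\<^esub> c) = \<tau> a b c"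
proof -
  have b: "bilin (\<lambda>a b. \<tau> a b c)" for c using \<tau> by (simp add: trilin_def)
  have F: "bilinear_on HH H scalars (\<lambda>s c. s (\<lambda>a b. \<tau> a b c))"
  proof (rule bilinear_onI)
    show "linmap H scalars (\<lambda>c. s (\<lambda>a b. \<tau> a b c))" if "s \<in> vcarrier HH" for s
      by (intro lin_eval_param[OF that] vspaces b trilin_arg3[OF \<tau>] lin_id)
  qed (rule linmap_eval)
  show ?thesis
  proof
    show "linmap (HH \<otimes>\<^sub>V H) scalars (\<lambda>t. sweedler HH H t (\<lambda>s c. s (\<lambda>a b. \<tau> a b c)))"
      by (rule linmap_sweedler[OF vspaces(3,1,2) F])
    show "sweedler HH H ((a \<otimes>\<^bsub>H,H\<^esub> b) \<otimes>\<^bsub>HH,H\<^esub> c) (\<lambda>s c. s (\<lambda>a b. \<tau> a b c)) = \<tau> a b c" for a b c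
      using eval_tensor[OF b] by (simp add: sweedler_tensor[OF vspaces(3,1,2) F] tensor_in_tensor_space)
  qed
qed

lemma trilin_bilin_counit:
  assumes \<beta>: "bilin \<beta>"
  shows "trilin (\<lambda>a b c. \<beta> a b * counit H c)" "trilin (\<lambda>a b c. counit H a * \<beta> b c)"
proof -
  note [intro!] = bilinI linear_intros bilin_arg1[OF \<beta>] bilin_arg2[OF \<beta>]
  show "trilin (\<lambda>a b c. \<beta> a b * counit H c)" "trilin (\<lambda>a b c. counit H a * \<beta> b c)"
    by (auto simp: trilin_def)
qed

text \<open>The axioms for \<open>\<rho>1\<close> and \<open>\<rho>2\<close> as identities between functionals.\<close>

lemma coassoc_\<rho>1:
  assumes C: "left_comodule H H \<rho>1" and \<tau>: "trilin \<tau>"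
  shows "\<rho>1 k (\<lambda>a n. comult H a (\<lambda>a1 a2. \<tau> a1 a2 n)) = \<rho>1 k (\<lambda>a n. \<rho>1 n (\<lambda>b n'. \<tau> a b n'))"
proof -
  obtain g where g: "linmap (H \<otimes>\<^sub>V HH) scalars g"
    and gs: "\<And>a s. s \<in> vcarrier HH \<Longrightarrow> g (a \<otimes>\<^bsub>H,HH\<^esub> s) = s (\<tau> a)"
    and gt: "\<And>a b c. g (a \<otimes>\<^bsub>H,HH\<^esub> (b \<otimes>\<^bsub>H,H\<^esub> c)) = \<tau> a b c"
    using trilinear_functional_left[OF \<tau>] by metis
  have 1: "bilinear_on H H (H \<otimes>\<^sub>V HH) (\<lambda>a1 a2. a1 \<otimes>\<^bsub>H,HH\<^esub> (a2 \<otimes>\<^bsub>H,H\<^esub> n))" for n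
    by (auto intro!: bilinear_onI linear_intros tensor_in_tensor_space)
  have 2: "bilinear_on H H (H \<otimes>\<^sub>V HH)
      (\<lambda>a n. sweedler H H (comult H a) (\<lambda>a1 a2. a1 \<otimes>\<^bsub>H,HH\<^esub> (a2 \<otimes>\<^bsub>H,H\<^esub> n)))"
    by (auto intro!: bilinear_onI[where V = H and W = H] 1 vspaces linear_intros tensor_in_tensor_space)
  have 3: "bilinear_on H H (H \<otimes>\<^sub>V HH) (\<lambda>a n. a \<otimes>\<^bsub>H,HH\<^esub> \<rho>1 n)"
    by (auto intro!: bilinear_onI linear_intros)
  have "sweedler H H (\<rho>1 k) (\<lambda>a n. sweedler H H (comult H a) (\<lambda>a1 a2. a1 \<otimes>\<^bsub>H,HH\<^esub> (a2 \<otimes>\<^bsub>H,H\<^esub> n)))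
      = sweedler H H (\<rho>1 k) (\<lambda>a n. a \<otimes>\<^bsub>H,HH\<^esub> \<rho>1 n)"
    using C by (simp add: left_comodule_def)
  from arg_cong[where f = g, OF this] show ?thesis
    by (simp add: eval_linmap_sweedler[OF \<rho>1_in vspaces(3) 2 g] eval_linmap_sweedler[OF \<rho>1_in vspaces(3) 3 g]
        eval_linmap_sweedler[OF comult_in_HH vspaces(3) 1 g] gs gt)
qed

lemma coassoc_\<rho>2:
  assumes C: "right_comodule H H \<rho>2" and \<tau>: "trilin \<tau>"
  shows "\<rho>2 k (\<lambda>n a. \<rho>2 n (\<lambda>n' b. \<tau> n' b a)) = \<rho>2 k (\<lambda>n a. comult H a (\<lambda>a1 a2. \<tau> n a1 a2))"
proof -
  obtain g where g: "linmap (H \<otimes>\<^sub>V HH) scalars g"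
    and gs: "\<And>a s. s \<in> vcarrier HH \<Longrightarrow> g (a \<otimes>\<^bsub>H,HH\<^esub> s) = s (\<tau> a)"
    and gt: "\<And>a b c. g (a \<otimes>\<^bsub>H,HH\<^esub> (b \<otimes>\<^bsub>H,H\<^esub> c)) = \<tau> a b c"
    using trilinear_functional_left[OF \<tau>] by metis
  have 1: "bilinear_on H H (H \<otimes>\<^sub>V HH) (\<lambda>n' b. n' \<otimes>\<^bsub>H,HH\<^esub> (b \<otimes>\<^bsub>H,H\<^esub> a))" for a
    by (auto intro!: bilinear_onI linear_intros tensor_in_tensor_space)
  have 2: "bilinear_on H H (H \<otimes>\<^sub>V HH)
      (\<lambda>n a. sweedler H H (\<rho>2 n) (\<lambda>n' b. n' \<otimes>\<^bsub>H,HH\<^esub> (b \<otimes>\<^bsub>H,H\<^esub> a)))"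
    by (auto intro!: bilinear_onI[where V = H and W = H] 1 vspaces linear_intros tensor_in_tensor_space)
  have 3: "bilinear_on H H (H \<otimes>\<^sub>V HH) (\<lambda>n a. n \<otimes>\<^bsub>H,HH\<^esub> comult H a)"
    by (auto intro!: bilinear_onI linear_intros)
  have "sweedler H H (\<rho>2 k) (\<lambda>n a. sweedler H H (\<rho>2 n) (\<lambda>n' b. n' \<otimes>\<^bsub>H,HH\<^esub> (b \<otimes>\<^bsub>H,H\<^esub> a)))
      = sweedler H H (\<rho>2 k) (\<lambda>n a. n \<otimes>\<^bsub>H,HH\<^esub> comult H a)"
    using C by (simp add: right_comodule_def)
  from arg_cong[where f = g, OF this] show ?thesis
    by (simp add: eval_linmap_sweedler[OF \<rho>2_in vspaces(3) 2 g] eval_linmap_sweedler[OF \<rho>2_in vspaces(3) 3 g]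
        eval_linmap_sweedler[OF \<rho>2_in vspaces(3) 1 g] gs gt)
qed

lemma counit_\<rho>1:
  assumes C: "left_comodule H H \<rho>1" and f: "lin f"
  shows "\<rho>1 k (\<lambda>a n. counit H a * f n) = f k"
proof -
  have 1: "bilinear_on H H H (\<lambda>a n. vscale H (counit H a) n)"
    by (auto intro!: bilinear_onI linear_intros)
  have "sweedler H H (\<rho>1 k) (\<lambda>a n. vscale H (counit H a) n) = k"
    using C by (simp add: left_comodule_def)
  then show ?thesis
    using eval_linmap_sweedler[OF \<rho>1_in vspaces(1) 1 f, of k] by (simp add: linmapD(3)[OF f])
qed

lemma counit_\<rho>2:
  assumes C: "right_comodule H H \<rho>2" and f: "lin f"
  shows "\<rho>2 k (\<lambda>n a. counit H a * f n) = f k"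
proof -
  have 1: "bilinear_on H H H (\<lambda>n a. vscale H (counit H a) n)"
    by (auto intro!: bilinear_onI linear_intros)
  have "sweedler H H (\<rho>2 k) (\<lambda>n a. vscale H (counit H a) n) = k"
    using C by (simp add: right_comodule_def)
  then show ?thesis
    using eval_linmap_sweedler[OF \<rho>2_in vspaces(1) 1 f, of k] by (simp add: linmapD(3)[OF f])
qed

text \<open>
  The Yetter-Drinfel'd-Long compatibilities on \<open>k \<otimes> 1\<close> and \<open>1 \<otimes> k\<close>, with the counit applied to
  the idle tensor factor.
\<close>

lemma compatible_\<rho>1:
  assumes Y: "yetter_drinfeld_long H M" and \<beta>: "bilin \<beta>"
  shows "comult H h (\<lambda>h1 h2. \<rho>1 (h1 * k) (\<lambda>a n. \<beta> (a * h2) n))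
    = comult H h (\<lambda>h1 h2. \<rho>1 k (\<lambda>a n. \<beta> (h1 * a) (h2 * n)))"
proof -
  obtain g where g: "linmap (H \<otimes>\<^sub>V HH) scalars g"
    and gt: "\<And>a b c. g (a \<otimes>\<^bsub>H,HH\<^esub> (b \<otimes>\<^bsub>H,H\<^esub> c)) = \<beta> a b * counit H c"
    using trilinear_functional_left[OF trilin_bilin_counit(1)[OF \<beta>]] by metis
  let ?m = "k \<otimes>\<^bsub>H,H\<^esub> 1"
  have m: "(x \<otimes>\<^bsub>H,H\<^esub> y) \<in> vcarrier HH" for x y by (simp add: tensor_in_tensor_space)
  have l1: "bilinear_on H HH (H \<otimes>\<^sub>V HH) (\<lambda>a n. (a * h2) \<otimes>\<^bsub>H,HH\<^esub> n)" for h2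
    by (auto intro!: bilinear_onI linear_intros)
  have l2: "bilinear_on H H (H \<otimes>\<^sub>V HH)
      (\<lambda>h1 h2. sweedler H HH (lcoact M (lact M h1 ?m)) (\<lambda>a n. (a * h2) \<otimes>\<^bsub>H,HH\<^esub> n))"
    by (auto intro!: bilinear_onI[where V = H and W = H] linear_intros l1 vspaces simp: m)
  have r1: "bilinear_on H HH (H \<otimes>\<^sub>V HH) (\<lambda>a n. (h1 * a) \<otimes>\<^bsub>H,HH\<^esub> lact M h2 n)" for h1 h2
    by (auto intro!: bilinear_onI linear_intros)
  have r2: "bilinear_on H H (H \<otimes>\<^sub>V HH)
      (\<lambda>h1 h2. sweedler H HH (lcoact M ?m) (\<lambda>a n. (h1 * a) \<otimes>\<^bsub>H,HH\<^esub> lact M h2 n))"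
    by (auto intro!: bilinear_onI[where V = H and W = H] linear_intros r1 vspaces simp: m)
  have l: "g (sweedler H HH (lcoact M (x \<otimes>\<^bsub>H,H\<^esub> 1)) (\<lambda>a n. (a * h2) \<otimes>\<^bsub>H,HH\<^esub> n))
      = \<rho>1 x (\<lambda>a n. \<beta> (a * h2) n)" for x h2
    unfolding linmap_lcoact[OF linmap_comp[OF g linmap_sweedler[OF vspaces(1,3,3) l1]]]
    by (simp add: sweedler_tensor[OF vspaces(1,3,3) l1] m gt)
  have r: "g (sweedler H HH (lcoact M ?m) (\<lambda>a n. (h1 * a) \<otimes>\<^bsub>H,HH\<^esub> lact M h2 n))
      = \<rho>1 k (\<lambda>a n. \<beta> (h1 * a) (h2 * n))" for h1 h2
    unfolding linmap_lcoact[OF linmap_comp[OF g linmap_sweedler[OF vspaces(1,3,3) r1]]]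
    by (simp add: sweedler_tensor[OF vspaces(1,3,3) r1] m gt)
  have "sweedler H H (comult H h) (\<lambda>h1 h2. sweedler H HH (lcoact M (lact M h1 ?m))
        (\<lambda>a n. (a * h2) \<otimes>\<^bsub>H,HH\<^esub> n))
      = sweedler H H (comult H h) (\<lambda>h1 h2. sweedler H HH (lcoact M ?m)
        (\<lambda>a n. (h1 * a) \<otimes>\<^bsub>H,HH\<^esub> lact M h2 n))"
    using yetter_drinfeld_long.lact_lcoact[OF Y, of ?m h] by (simp add: m del: lact_tensor)
  from arg_cong[where f = g, OF this] show ?thesis
    unfolding eval_linmap_sweedler[OF comult_in_HH vspaces(3) l2 g] eval_linmap_sweedler[OF comult_in_HH vspaces(3) r2 g]
    by (simp add: l r)
qed

lemma compatible_\<rho>2: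
  assumes Y: "yetter_drinfeld_long H M" and \<beta>: "bilin \<beta>"
  shows "comult H h (\<lambda>h1 h2. \<rho>2 (k * h2) (\<lambda>n b. \<beta> n (h1 * b)))
    = comult H h (\<lambda>h1 h2. \<rho>2 k (\<lambda>n b. \<beta> (n * h1) (b * h2)))"
proof -
  obtain g where g: "linmap (HH \<otimes>\<^sub>V H) scalars g"
    and gt: "\<And>a b c. g ((a \<otimes>\<^bsub>H,H\<^esub> b) \<otimes>\<^bsub>HH,H\<^esub> c) = counit H a * \<beta> b c"
    using trilinear_functional_right[OF trilin_bilin_counit(2)[OF \<beta>]] by metis
  let ?m = "1 \<otimes>\<^bsub>H,H\<^esub> k"
  have m: "(x \<otimes>\<^bsub>H,H\<^esub> y) \<in> vcarrier HH" for x y by (simp add: tensor_in_tensor_space)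
  have l1: "bilinear_on HH H (HH \<otimes>\<^sub>V H) (\<lambda>n b. n \<otimes>\<^bsub>HH,H\<^esub> (h1 * b))" for h1
    by (auto intro!: bilinear_onI linear_intros)
  have l2: "bilinear_on H H (HH \<otimes>\<^sub>V H)
      (\<lambda>h1 h2. sweedler HH H (rcoact M (ract M ?m h2)) (\<lambda>n b. n \<otimes>\<^bsub>HH,H\<^esub> (h1 * b)))"
    by (auto intro!: bilinear_onI[where V = H and W = H] linear_intros l1 vspaces simp: m)
  have r1: "bilinear_on HH H (HH \<otimes>\<^sub>V H) (\<lambda>n b. ract M n h1 \<otimes>\<^bsub>HH,H\<^esub> (b * h2))" for h1 h2
    by (auto intro!: bilinear_onI linear_intros)
  have r2: "bilinear_on H H (HH \<otimes>\<^sub>V H)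
      (\<lambda>h1 h2. sweedler HH H (rcoact M ?m) (\<lambda>n b. ract M n h1 \<otimes>\<^bsub>HH,H\<^esub> (b * h2)))"
    by (auto intro!: bilinear_onI[where V = H and W = H] linear_intros r1 vspaces simp: m)
  have l: "g (sweedler HH H (rcoact M (1 \<otimes>\<^bsub>H,H\<^esub> x)) (\<lambda>n b. n \<otimes>\<^bsub>HH,H\<^esub> (h1 * b)))
      = \<rho>2 x (\<lambda>n b. \<beta> n (h1 * b))" for x h1
    unfolding linmap_rcoact[OF linmap_comp[OF g linmap_sweedler[OF vspaces(3,1,3) l1]]]
    by (simp add: sweedler_tensor[OF vspaces(3,1,3) l1] m gt)
  have r: "g (sweedler HH H (rcoact M ?m) (\<lambda>n b. ract M n h1 \<otimes>\<^bsub>HH,H\<^esub> (b * h2)))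
      = \<rho>2 k (\<lambda>n b. \<beta> (n * h1) (b * h2))" for h1 h2
    unfolding linmap_rcoact[OF linmap_comp[OF g linmap_sweedler[OF vspaces(3,1,3) r1]]]
    by (simp add: sweedler_tensor[OF vspaces(3,1,3) r1] m gt)
  have "sweedler H H (comult H h) (\<lambda>h1 h2. sweedler HH H (rcoact M (ract M ?m h2))
        (\<lambda>n b. n \<otimes>\<^bsub>HH,H\<^esub> (h1 * b)))
      = sweedler H H (comult H h) (\<lambda>h1 h2. sweedler HH H (rcoact M ?m)
        (\<lambda>n b. ract M n h1 \<otimes>\<^bsub>HH,H\<^esub> (b * h2)))"
    using yetter_drinfeld_long.ract_rcoact[OF Y, of ?m h] by (simp add: m del: ract_tensor)
  from arg_cong[where f = g, OF this] show ?thesis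
    unfolding eval_linmap_sweedler[OF comult_in_HH vspaces(3) l2 g] eval_linmap_sweedler[OF comult_in_HH vspaces(3) r2 g]
    by (simp add: l r)
qed

lemma bilin_counit: "bilin (\<lambda>x y. counit H x * counit H y)"
  by (auto intro!: bilinI linear_intros)

text \<open>
  The form \<open>\<epsilon> \<otimes> \<epsilon>\<close> is invariant under the square of either factor of the braiding, so testing against
  \<open>\<beta> \<otimes> (\<epsilon> \<otimes> \<epsilon>)\<close> isolates the square of the other factor, with no scalar ambiguity.
\<close>

lemma involution_\<rho>1:
  assumes C2: "right_comodule H H \<rho>2"
    and sym: "\<And>t. t \<in> vcarrier (HH \<otimes>\<^sub>V HH) \<Longrightarrow> braiding H M M (braiding H M M t) = t"
    and \<beta>: "bilin \<beta>"
  shows "\<rho>1 k (\<lambda>a n. \<rho>1 (a * k') (\<lambda>b n'. \<beta> (b * n) n')) = \<beta> k k'"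
proof -
  let ?e = "counit H"
  note [intro!] = bilinI linear_intros vspaces bilin_arg1[OF \<beta>] bilin_arg2[OF \<beta>]
  have e: "lin ?e" by auto
  obtain g where g: "linmap (HH \<otimes>\<^sub>V HH) scalars g"
    and gt: "\<And>x y x' y'. g ((x \<otimes>\<^bsub>H,H\<^esub> y) \<otimes>\<^bsub>HH,HH\<^esub> (x' \<otimes>\<^bsub>H,H\<^esub> y')) = \<beta> x x' * (?e y * ?e y')"
    using product_functional[OF \<beta> bilin_counit] by metis
  have 1: "\<rho>2 b (\<lambda>l1 b'. c * (?e l1 * ?e (l0 * b'))) = (?e l0 * ?e b) * c" for b c l0
  proof -
    have "\<rho>2 b (\<lambda>l1 b'. c * (?e l1 * ?e (l0 * b'))) = \<rho>2 b (\<lambda>l1 b'. (?e l0 * c) * (?e b' * ?e l1))"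
      by (simp add: counit_mult mult_ac)
    also have "\<dots> = (?e l0 * c) * \<rho>2 b (\<lambda>l1 b'. ?e b' * ?e l1)"
      by (rule eval_mult_left) auto
    finally show ?thesis unfolding counit_\<rho>2[OF C2 e] by (simp add: mult_ac)
  qed
  have 2: "\<rho>1 x (\<lambda>a' k1. (?e l0 * ?e b) * \<beta> (a' * k0) k1) = (?e l0 * ?e b) * \<rho>1 x (\<lambda>a' k1. \<beta> (a' * k0) k1)"
    for x l0 b k0 by (rule eval_mult_left) auto
  have 3: "\<rho>2 1 (\<lambda>l0 b. (?e l0 * ?e b) * c) = c" for c
  proof -
    have "\<rho>2 1 (\<lambda>l0 b. c * (?e b * ?e l0)) = c * \<rho>2 1 (\<lambda>l0 b. ?e b * ?e l0)"
      by (rule eval_mult_left) auto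
    then show ?thesis unfolding counit_\<rho>2[OF C2 e] by (simp add: mult_ac)
  qed
  let ?t = "(k \<otimes>\<^bsub>H,H\<^esub> 1) \<otimes>\<^bsub>HH,HH\<^esub> (k' \<otimes>\<^bsub>H,H\<^esub> 1)"
  have "g (braiding H M M (braiding H M M ?t)) = g ?t"
    by (simp add: sym tensor_in_tensor_space)
  then show ?thesis
    unfolding functional_braiding_braiding[OF g] by (simp add: gt 1 2 3)
qed

lemma involution_\<rho>2:
  assumes C1: "left_comodule H H \<rho>1"
    and sym: "\<And>t. t \<in> vcarrier (HH \<otimes>\<^sub>V HH) \<Longrightarrow> braiding H M M (braiding H M M t) = t"
    and \<gamma>: "bilin \<gamma>"
  shows "\<rho>2 l' (\<lambda>n a. \<rho>2 (l * a) (\<lambda>n' b. \<gamma> n' (n * b))) = \<gamma> l l'"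
proof -
  let ?e = "counit H"
  note [intro!] = bilinI linear_intros vspaces bilin_arg1[OF \<gamma>] bilin_arg2[OF \<gamma>]
  have e: "lin ?e" by auto
  obtain g where g: "linmap (HH \<otimes>\<^sub>V HH) scalars g"
    and gt: "\<And>x y x' y'. g ((x \<otimes>\<^bsub>H,H\<^esub> y) \<otimes>\<^bsub>HH,HH\<^esub> (x' \<otimes>\<^bsub>H,H\<^esub> y')) = (?e x * ?e x') * \<gamma> y y'"
    using product_functional[OF bilin_counit \<gamma>] by metis
  have 1: "\<rho>2 x (\<lambda>l1 b'. (?e (a' * k0) * ?e k1) * \<gamma> l1 (l0 * b'))
      = (?e (a' * k0) * ?e k1) * \<rho>2 x (\<lambda>l1 b'. \<gamma> l1 (l0 * b'))" for x a' k0 k1 l0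
    by (rule eval_mult_left) auto
  have 2: "\<rho>1 a (\<lambda>a' k1. (?e (a' * k0) * ?e k1) * c) = (?e a * ?e k0) * c" for a k0 c
  proof -
    have "\<rho>1 a (\<lambda>a' k1. (?e (a' * k0) * ?e k1) * c) = \<rho>1 a (\<lambda>a' k1. (?e k0 * c) * (?e a' * ?e k1))"
      by (simp add: counit_mult mult_ac)
    also have "\<dots> = (?e k0 * c) * \<rho>1 a (\<lambda>a' k1. ?e a' * ?e k1)"
      by (rule eval_mult_left) auto
    finally show ?thesis unfolding counit_\<rho>1[OF C1 e] by (simp add: mult_ac)
  qed
  have 3: "\<rho>2 l' (\<lambda>l0 b. (?e a * ?e k0) * \<rho>2 (l * b) (\<lambda>l1 b'. \<gamma> l1 (l0 * b')))
      = (?e a * ?e k0) * \<rho>2 l' (\<lambda>l0 b. \<rho>2 (l * b) (\<lambda>l1 b'. \<gamma> l1 (l0 * b')))" for a k0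
    by (rule eval_mult_left) auto
  have 4: "\<rho>1 1 (\<lambda>a k0. (?e a * ?e k0) * c) = c" for c
  proof -
    have "\<rho>1 1 (\<lambda>a k0. c * (?e a * ?e k0)) = c * \<rho>1 1 (\<lambda>a k0. ?e a * ?e k0)"
      by (rule eval_mult_left) auto
    then show ?thesis unfolding counit_\<rho>1[OF C1 e] by (simp add: mult_ac)
  qed
  let ?t = "(1 \<otimes>\<^bsub>H,H\<^esub> l) \<otimes>\<^bsub>HH,HH\<^esub> (1 \<otimes>\<^bsub>H,H\<^esub> l')"
  have "g (braiding H M M (braiding H M M ?t)) = g ?t"
    by (simp add: sym tensor_in_tensor_space)
  then show ?thesis
    unfolding functional_braiding_braiding[OF g] by (simp add: gt 1 2 3 4)
qed

lemma triangular_of_symmetry: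
  assumes C1: "left_comodule H H \<rho>1" and C2: "right_comodule H H \<rho>2"
    and Y: "yetter_drinfeld_long H M"
    and sym: "\<And>t. t \<in> vcarrier (HH \<otimes>\<^sub>V HH) \<Longrightarrow> braiding H M M (braiding H M M t) = t"
  shows "triangular H (tflip H (\<rho>1 1))" "left_induced H (tflip H (\<rho>1 1)) (lcoact M)"
    and "triangular H (\<rho>2 1)" "right_induced H (\<rho>2 1) (rcoact M)"
proof -
  note L = left.triangular_form_of_involution[OF linmap_\<rho>1 coassoc_\<rho>1[OF C1] counit_\<rho>1[OF C1]
      compatible_\<rho>1[OF Y] involution_\<rho>1[OF C2 sym]]
  show "triangular H (tflip H (\<rho>1 1))"
    by (rule triangular_of_triangular_form) (rule L(1))
  show "left_induced H (tflip H (\<rho>1 1)) (lcoact M)"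
    unfolding left_induced_def
  proof (intro allI tensor_eqI[OF vspaces(1)])
    fix k l B
    have R: "tflip H (\<rho>1 1) \<in> vcarrier HH" by simp
    have 1: "bilinear_on H H (H \<otimes>\<^sub>V HH) (\<lambda>R1 R2. R2 \<otimes>\<^bsub>H,HH\<^esub> ((R1 * k) \<otimes>\<^bsub>H,H\<^esub> l))"
      by (auto intro!: bilinear_onI linear_intros tensor_in_tensor_space)
    show "lcoact M (k \<otimes>\<^bsub>H,H\<^esub> l) \<in> vcarrier (H \<otimes>\<^sub>V HH)"
      by (simp add: tensor_in_tensor_space)
    show "sweedler H H (tflip H (\<rho>1 1)) (\<lambda>R1 R2. R2 \<otimes>\<^bsub>H,HH\<^esub> ((R1 * k) \<otimes>\<^bsub>H,H\<^esub> l)) \<in> vcarrier (H \<otimes>\<^sub>V HH)"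
      by (rule sweedler_in[OF R vspaces(3) 1])
    have b: "bilin (\<lambda>a k0. (a \<otimes>\<^bsub>H,HH\<^esub> (k0 \<otimes>\<^bsub>H,H\<^esub> l)) B)"
      "bilin (\<lambda>R1 R2. (R2 \<otimes>\<^bsub>H,HH\<^esub> ((R1 * k) \<otimes>\<^bsub>H,H\<^esub> l)) B)"
      by (auto intro!: bilinI linear_intros tensor_in_tensor_space)
    show "lcoact M (k \<otimes>\<^bsub>H,H\<^esub> l) B
        = sweedler H H (tflip H (\<rho>1 1)) (\<lambda>R1 R2. R2 \<otimes>\<^bsub>H,HH\<^esub> ((R1 * k) \<otimes>\<^bsub>H,H\<^esub> l)) B"
      unfolding linmap_lcoact[OF linmap_eval] eval_sweedler[OF R 1] eval_tflip[OF \<rho>1_in b(2)]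
      by (rule L(2)[OF _ _ _ _ _ b(1)])
  qed
  \<comment> \<open>over the opposite and co-opposite bialgebra, the flipped right coaction is a left coaction\<close>
  let ?\<rho> = "\<lambda>h. tflip H (\<rho>2 h)"
  have \<rho>: "linmap H HH ?\<rho>" by (rule linmap_comp[OF linmap_tflip linmap_\<rho>2])
  have co: "?\<rho> k (\<lambda>a n. tflip H (comult H a) (\<lambda>a1 a2. \<tau> a1 a2 n)) = ?\<rho> k (\<lambda>a n. ?\<rho> n (\<lambda>b n'. \<tau> a b n'))"
    if t: "trilin \<tau>" for k \<tau>
  proof -
    note [intro!] = bilinI linear_intros vspaces trilin_arg1[OF t] trilin_arg2[OF t] trilin_arg3[OF t]
    have t': "trilin (\<lambda>n' b a. \<tau> a b n')" by (auto simp: trilin_def)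
    have b: "bilin (\<lambda>a1 a2. \<tau> a1 a2 n)" "bilin (\<tau> n)"
      "bilin (\<lambda>a n. comult H a (\<lambda>a1 a2. \<tau> a2 a1 n))" "bilin (\<lambda>a n. \<rho>2 n (\<lambda>n' b. \<tau> a b n'))" for n by auto
    show ?thesis
      using coassoc_\<rho>2[OF C2 t', of k] by (simp add: eval_tflip b)
  qed
  have cou: "?\<rho> k (\<lambda>a n. counit H a * f n) = f k" if f: "lin f" for k f
  proof -
    have "bilin (\<lambda>a n. counit H a * f n)" by (auto intro!: bilinI linear_intros lin_arg[OF f])
    then show ?thesis using counit_\<rho>2[OF C2 f, of k] by (simp add: eval_tflip)
  qed
  have yd: "tflip H (comult H h) (\<lambda>h1 h2. ?\<rho> (k * h1) (\<lambda>a n. \<beta> (h2 * a) n))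
      = tflip H (comult H h) (\<lambda>h1 h2. ?\<rho> k (\<lambda>a n. \<beta> (a * h1) (n * h2)))"
    if \<beta>: "bilin \<beta>" for h k \<beta>
  proof -
    note [intro!] = bilinI linear_intros vspaces bilin_arg1[OF \<beta>] bilin_arg2[OF \<beta>]
    have b: "bilin (\<lambda>a n. \<beta> (x * a) n)" "bilin (\<lambda>a n. \<beta> (a * x) (n * y))"
      "bilin (\<lambda>h1 h2. \<rho>2 (k * h1) (\<lambda>n a. \<beta> (h2 * a) n))"
      "bilin (\<lambda>h1 h2. \<rho>2 k (\<lambda>n a. \<beta> (a * h1) (n * h2)))" for x y by auto
    show ?thesis
      using compatible_\<rho>2[OF Y bilin_flip[OF \<beta>], of h k] by (simp add: eval_tflip b)
  qed
  have inv: "?\<rho> k (\<lambda>a n. ?\<rho> (k' * a) (\<lambda>b n'. \<beta> (n * b) n')) = \<beta> k k'" if \<beta>: "bilin \<beta>" for k k' \<beta>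
  proof -
    note [intro!] = bilinI linear_intros vspaces bilin_arg1[OF \<beta>] bilin_arg2[OF \<beta>]
    have b: "bilin (\<lambda>b n'. \<beta> (n * b) n')" "bilin (\<lambda>a n. \<rho>2 (k' * a) (\<lambda>n' b. \<beta> (n * b) n'))" for n by auto
    show ?thesis
      using involution_\<rho>2[OF C1 sym bilin_flip[OF \<beta>], of k k'] by (simp add: eval_tflip b)
  qed
  note R = right.triangular_form_of_involution[OF \<rho> co cou yd inv]
  have "triangular H (tflip H (tflip H (\<rho>2 1)))"
    by (rule triangular_of_triangular_form, rule triangular_form_left_of_right) (rule R(1))
  then show "triangular H (\<rho>2 1)" by (simp add: tflip_tflip)
  show "right_induced H (\<rho>2 1) (rcoact M)"
    unfolding right_induced_def
  proof (intro allI tensor_eqI[OF vspaces(3)])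
    fix k l B
    have 1: "bilinear_on H H (HH \<otimes>\<^sub>V H) (\<lambda>R1 R2. (k \<otimes>\<^bsub>H,H\<^esub> (l * R1)) \<otimes>\<^bsub>HH,H\<^esub> R2)"
      by (auto intro!: bilinear_onI linear_intros tensor_in_tensor_space)
    show "rcoact M (k \<otimes>\<^bsub>H,H\<^esub> l) \<in> vcarrier (HH \<otimes>\<^sub>V H)"
      by (simp add: tensor_in_tensor_space)
    show "sweedler H H (\<rho>2 1) (\<lambda>R1 R2. (k \<otimes>\<^bsub>H,H\<^esub> (l * R1)) \<otimes>\<^bsub>HH,H\<^esub> R2) \<in> vcarrier (HH \<otimes>\<^sub>V H)"
      by (rule sweedler_in[OF \<rho>2_in vspaces(3) 1])
    have b: "bilin (\<lambda>b l0. ((k \<otimes>\<^bsub>H,H\<^esub> l0) \<otimes>\<^bsub>HH,H\<^esub> b) B)"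
      "bilin (\<lambda>b l0. ((k \<otimes>\<^bsub>H,H\<^esub> (l * l0)) \<otimes>\<^bsub>HH,H\<^esub> b) B)"
      by (auto intro!: bilinI linear_intros tensor_in_tensor_space)
    have "?\<rho> l (\<lambda>b l0. ((k \<otimes>\<^bsub>H,H\<^esub> l0) \<otimes>\<^bsub>HH,H\<^esub> b) B)
        = ?\<rho> 1 (\<lambda>b l0. ((k \<otimes>\<^bsub>H,H\<^esub> (l * l0)) \<otimes>\<^bsub>HH,H\<^esub> b) B)"
      by (rule R(2)[OF _ _ _ _ b(1)])
    then show "rcoact M (k \<otimes>\<^bsub>H,H\<^esub> l) B
        = sweedler H H (\<rho>2 1) (\<lambda>R1 R2. (k \<otimes>\<^bsub>H,H\<^esub> (l * R1)) \<otimes>\<^bsub>HH,H\<^esub> R2) B"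
      unfolding linmap_rcoact[OF linmap_eval] eval_sweedler[OF \<rho>2_in 1] eval_tflip[OF \<rho>2_in b(1)]
        eval_tflip[OF \<rho>2_in b(2)] .
  qed
qed

lemma eval_induced_\<rho>1:
  assumes I: "left_induced H R (lcoact M)" and R: "R \<in> vcarrier HH" and \<beta>: "bilin \<beta>"
  shows "\<rho>1 k \<beta> = R (\<lambda>x y. \<beta> y (x * k))"
proof -
  obtain g where g: "linmap (H \<otimes>\<^sub>V HH) scalars g"
    and gt: "\<And>a b c. g (a \<otimes>\<^bsub>H,HH\<^esub> (b \<otimes>\<^bsub>H,H\<^esub> c)) = \<beta> a b * counit H c"
    using trilinear_functional_left[OF trilin_bilin_counit(1)[OF \<beta>]] by metis
  have 1: "bilinear_on H H (H \<otimes>\<^sub>V HH) (\<lambda>R1 R2. R2 \<otimes>\<^bsub>H,HH\<^esub> ((R1 * k) \<otimes>\<^bsub>H,H\<^esub> 1))"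
    by (auto intro!: bilinear_onI linear_intros tensor_in_tensor_space)
  have "g (lcoact M (k \<otimes>\<^bsub>H,H\<^esub> 1)) = g (sweedler H H R (\<lambda>R1 R2. R2 \<otimes>\<^bsub>H,HH\<^esub> ((R1 * k) \<otimes>\<^bsub>H,H\<^esub> 1)))"
    using I by (simp add: left_induced_def)
  then show ?thesis
    unfolding linmap_lcoact[OF g] eval_linmap_sweedler[OF R vspaces(3) 1 g] by (simp add: gt)
qed

lemma eval_induced_\<rho>2:
  assumes I: "right_induced H S (rcoact M)" and S: "S \<in> vcarrier HH" and \<beta>: "bilin \<beta>"
  shows "\<rho>2 l \<beta> = S (\<lambda>x y. \<beta> (l * x) y)"
proof -
  obtain g where g: "linmap (HH \<otimes>\<^sub>V H) scalars g"
    and gt: "\<And>a b c. g ((a \<otimes>\<^bsub>H,H\<^esub> b) \<otimes>\<^bsub>HH,H\<^esub> c) = counit H a * \<beta> b c"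
    using trilinear_functional_right[OF trilin_bilin_counit(2)[OF \<beta>]] by metis
  have 1: "bilinear_on H H (HH \<otimes>\<^sub>V H) (\<lambda>R1 R2. (1 \<otimes>\<^bsub>H,H\<^esub> (l * R1)) \<otimes>\<^bsub>HH,H\<^esub> R2)"
    by (auto intro!: bilinear_onI linear_intros tensor_in_tensor_space)
  have "g (rcoact M (1 \<otimes>\<^bsub>H,H\<^esub> l)) = g (sweedler H H S (\<lambda>R1 R2. (1 \<otimes>\<^bsub>H,H\<^esub> (l * R1)) \<otimes>\<^bsub>HH,H\<^esub> R2))"
    using I by (simp add: right_induced_def)
  then show ?thesis
    unfolding linmap_rcoact[OF g] eval_linmap_sweedler[OF S vspaces(3) 1 g] by (simp add: gt)
qed

lemma triangular_eval:
  assumes "triangular H R" and \<beta>: "bilin \<beta>"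
  shows "R (\<lambda>a b. R (\<lambda>c d. \<beta> (b * c) (a * d))) = \<beta> 1 1"
proof -
  have R: "R \<in> vcarrier HH" and inv: "tmult H (tflip H R) R = (1 \<otimes>\<^bsub>H,H\<^esub> 1)"
    using assms(1) by (simp_all add: triangular_def quasitriangular_def is_tinverse_def)
  note [intro!] = bilinI linear_intros lin_eval_param[OF R] vspaces bilin_arg1[OF \<beta>] bilin_arg2[OF \<beta>]
  have b: "bilin (\<lambda>b a. R (\<lambda>c d. \<beta> (b * c) (a * d)))" using R by auto
  have "tmult H (tflip H R) R \<beta> = R (\<lambda>a b. R (\<lambda>c d. \<beta> (b * c) (a * d)))"
    by (simp add: eval_tmult R \<beta> eval_tflip b)
  then show ?thesis by (simp add: inv eval_tensor \<beta>)
qed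

lemma symmetry_of_triangular:
  assumes R: "triangular H R" "left_induced H R (lcoact M)"
    and S: "triangular H S" "right_induced H S (rcoact M)"
    and t: "t \<in> vcarrier (HH \<otimes>\<^sub>V HH)"
  shows "braiding H M M (braiding H M M t) = t"
proof -
  have Rin [simp]: "R \<in> vcarrier HH" and Sin [simp]: "S \<in> vcarrier HH"
    using R(1) S(1) by (simp_all add: triangular_def quasitriangular_def)
  let ?B = "\<lambda>t. braiding H M M (braiding H M M t)"
  have BB: "linmap (HH \<otimes>\<^sub>V HH) (HH \<otimes>\<^sub>V HH) ?B"
    by (rule linmap_comp[OF linmap_braiding linmap_braiding])
  have tin [simp]: "(x \<otimes>\<^bsub>H,H\<^esub> y) \<in> vcarrier HH" for x y
    by (simp add: tensor_in_tensor_space)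
  have pure: "?B ((k \<otimes>\<^bsub>H,H\<^esub> l) \<otimes>\<^bsub>HH,HH\<^esub> (k' \<otimes>\<^bsub>H,H\<^esub> l')) = ((k \<otimes>\<^bsub>H,H\<^esub> l) \<otimes>\<^bsub>HH,HH\<^esub> (k' \<otimes>\<^bsub>H,H\<^esub> l'))"
    for k l k' l'
  proof (rule tensor_eqI[OF vspaces(3)])
    let ?t = "(k \<otimes>\<^bsub>H,H\<^esub> l) \<otimes>\<^bsub>HH,HH\<^esub> (k' \<otimes>\<^bsub>H,H\<^esub> l')"
    show t_in: "?t \<in> vcarrier (HH \<otimes>\<^sub>V HH)" by (simp add: tensor_in_tensor_space)
    show "?B ?t \<in> vcarrier (HH \<otimes>\<^sub>V HH)" by (rule linmapD(1)[OF BB t_in])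
    fix B
    define f where "f x y x' y' = ((x \<otimes>\<^bsub>H,H\<^esub> y) \<otimes>\<^bsub>HH,HH\<^esub> (x' \<otimes>\<^bsub>H,H\<^esub> y')) B" for x y x' y'
    have f: "linmap H H u \<Longrightarrow> lin (\<lambda>z. f (u z) y x' y')" "linmap H H u \<Longrightarrow> lin (\<lambda>z. f x (u z) x' y')"
      "linmap H H u \<Longrightarrow> lin (\<lambda>z. f x y (u z) y')" "linmap H H u \<Longrightarrow> lin (\<lambda>z. f x y x' (u z))"
      for u x y x' y' unfolding f_def by (auto intro!: linear_intros)
    note [intro!] = bilinI linear_intros lin_eval_param[OF Rin] lin_eval_param[OF Sin] vspaces f
    \<comment> \<open>replace the four coactions by \<open>R\<close> and \<open>S\<close>, from the innermost one outwards\<close>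
    have 1: "\<rho>2 x (\<lambda>l1 b'. f (a' * k0) l1 k1 (l0 * b')) = S (\<lambda>t1 t2. f (a' * k0) (x * t1) k1 (l0 * t2))"
      for x a' k0 k1 l0
      by (rule eval_induced_\<rho>2[OF S(2) Sin]) auto
    have 2: "\<rho>1 x (\<lambda>a' k1. S (\<lambda>t1 t2. f (a' * k0) (y * t1) k1 (l0 * t2)))
        = R (\<lambda>x' y'. S (\<lambda>t1 t2. f (y' * k0) (y * t1) (x' * x) (l0 * t2)))" for x k0 y l0
      by (rule eval_induced_\<rho>1[OF R(2) Rin]) auto
    have 3: "\<rho>2 l' (\<lambda>l0 b. R (\<lambda>x' y'. S (\<lambda>t1 t2. f (y' * k0) (l * b * t1) (x' * x) (l0 * t2))))
        = S (\<lambda>s1 s2. R (\<lambda>x' y'. S (\<lambda>t1 t2. f (y' * k0) (l * s2 * t1) (x' * x) (l' * s1 * t2))))" for x k0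
      by (rule eval_induced_\<rho>2[OF S(2) Sin]) auto
    have 4: "S (\<lambda>s1 s2. R (\<lambda>x' y'. S (\<lambda>t1 t2. f (y' * k0) (l * s2 * t1) (x' * x) (l' * s1 * t2))))
        = R (\<lambda>x' y'. f (y' * k0) l (x' * x) l')" for x k0
    proof -
      have "S (\<lambda>s1 s2. R (\<lambda>x' y'. S (\<lambda>t1 t2. f (y' * k0) (l * s2 * t1) (x' * x) (l' * s1 * t2))))
          = R (\<lambda>x' y'. S (\<lambda>s1 s2. S (\<lambda>t1 t2. f (y' * k0) (l * s2 * t1) (x' * x) (l' * s1 * t2))))"
        by (rule eval_swap[OF Sin Rin]) auto
      moreover have "S (\<lambda>s1 s2. S (\<lambda>t1 t2. f (y' * k0) (l * s2 * t1) (x' * x) (l' * s1 * t2)))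
          = f (y' * k0) l (x' * x) l'" for x' y'
      proof -
        have "bilin (\<lambda>u v. f (y' * k0) (l * u) (x' * x) (l' * v))" by auto
        from triangular_eval[OF S(1) this] show ?thesis by (simp add: mult.assoc)
      qed
      ultimately show ?thesis by simp
    qed
    have 5: "\<rho>1 k (\<lambda>a k0. R (\<lambda>x' y'. f (y' * k0) l (x' * (a * k')) l'))
        = R (\<lambda>x y. R (\<lambda>x' y'. f (y' * (x * k)) l (x' * (y * k')) l'))"
      by (rule eval_induced_\<rho>1[OF R(2) Rin]) auto
    have 6: "R (\<lambda>x y. R (\<lambda>x' y'. f (y' * (x * k)) l (x' * (y * k')) l')) = f k l k' l'"
    proof -
      have "R (\<lambda>x y. R (\<lambda>x' y'. f (y' * (x * k)) l (x' * (y * k')) l'))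
          = R (\<lambda>x' y'. R (\<lambda>x y. f (y' * (x * k)) l (x' * (y * k')) l'))"
        by (rule eval_swap[OF Rin Rin]) auto
      also have "\<dots> = f k l k' l'"
      proof -
        have "bilin (\<lambda>u v. f (u * k) l (v * k') l')" by auto
        from triangular_eval[OF R(1) this] show ?thesis by (simp add: mult.assoc)
      qed
      finally show ?thesis .
    qed
    have "?B ?t B = \<rho>1 k (\<lambda>a k0. \<rho>2 l' (\<lambda>l0 b. \<rho>1 (a * k') (\<lambda>a' k1. \<rho>2 (l * b) (\<lambda>l1 b'.
        f (a' * k0) l1 k1 (l0 * b')))))"
      unfolding functional_braiding_braiding[OF linmap_eval] f_def ..
    also have "\<dots> = ?t B"
      unfolding 1 2 3 4 5 6 by (simp add: f_def)
    finally show "?B ?t B = ?t B" .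
  qed
  have step: "?B (m \<otimes>\<^bsub>HH,HH\<^esub> (k' \<otimes>\<^bsub>H,H\<^esub> l')) = (m \<otimes>\<^bsub>HH,HH\<^esub> (k' \<otimes>\<^bsub>H,H\<^esub> l'))" if "m \<in> vcarrier HH" for m k' l'
    by (rule linmap_tensor_space_eqI[where f = "\<lambda>m. ?B (m \<otimes>\<^bsub>HH,HH\<^esub> (k' \<otimes>\<^bsub>H,H\<^esub> l'))", OF vspaces(1) _ _ pure that])
      (auto intro!: linmap_comp[OF BB] linear_intros)
  have "?B (m \<otimes>\<^bsub>HH,HH\<^esub> n) = (m \<otimes>\<^bsub>HH,HH\<^esub> n)" if "m \<in> vcarrier HH" "n \<in> vcarrier HH" for m n
    by (rule linmap_tensor_space_eqI[where f = "\<lambda>n. ?B (m \<otimes>\<^bsub>HH,HH\<^esub> n)", OF vspaces(1) _ _ step[OF that(1)] that(2)])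
      (use that in \<open>auto intro!: linmap_comp[OF BB] linear_intros\<close>)
  then show ?thesis
    by (intro linmap_tensor_space_eqI[OF vspaces(3) BB lin_id _ t])
qed

end

theorem theorem5p3:
  fixes H :: "('k::field, 'h::ring_1) hopf"
    and \<rho>1 \<rho>2 :: "'h \<Rightarrow> ('k, 'h, 'h) tensor"
  assumes "hopf_algebra H"
    and "bij (antipode H)"
    and "left_comodule H H \<rho>1"
    and "right_comodule H H \<rho>2"
    and "yetter_drinfeld_long H (tensor_square H \<rho>1 \<rho>2)"
  shows
    "let M = tensor_square H \<rho>1 \<rho>2;
         symmetry = (\<forall>t\<in>vcarrier (M \<otimes>\<^sub>V M). braiding H M M (braiding H M M t) = t)
     in (symmetry \<longleftrightarrow>
           (\<exists>R S. triangular H R \<and> left_induced H R (lcoact M)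
              \<and> triangular H S \<and> right_induced H S (rcoact M)))
      \<and> (\<rho>2 1 = tflip H (\<rho>1 1) \<longrightarrow>
           (symmetry \<longleftrightarrow>
              (\<exists>R. triangular H R \<and> left_induced H R (lcoact M) \<and> right_induced H R (rcoact M))))
      \<and> (\<forall>R. triangular H R \<and> left_induced H R (lcoact M) \<longrightarrow>
           lcoact M (1 \<otimes>\<^bsub>H,H\<^esub> 1)
             = sweedler H H R (\<lambda>R1 R2. R2 \<otimes>\<^bsub>H,H \<otimes>\<^sub>V H\<^esub> (R1 \<otimes>\<^bsub>H,H\<^esub> 1)))
      \<and> (\<forall>R. triangular H R \<and> right_induced H R (rcoact M) \<longrightarrow>
           rcoact M (1 \<otimes>\<^bsub>H,H\<^esub> 1)
             = sweedler H H R (\<lambda>R1 R2. (1 \<otimes>\<^bsub>H,H\<^esub> R1) \<otimes>\<^bsub>H \<otimes>\<^sub>V H,H\<^esub> R2))"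
proof -
  interpret hopf_algebra H by fact
  interpret tensor_square_coactions H \<rho>1 \<rho>2
    using assms(3,4) by unfold_locales (simp_all add: left_comodule_def right_comodule_def)
  have forward: "triangular H (tflip H (\<rho>1 1)) \<and> left_induced H (tflip H (\<rho>1 1)) (lcoact M)
      \<and> triangular H (\<rho>2 1) \<and> right_induced H (\<rho>2 1) (rcoact M)"
    if "\<forall>t\<in>vcarrier (M \<otimes>\<^sub>V M). braiding H M M (braiding H M M t) = t"
    using triangular_of_symmetry[OF assms(3-5)] that by simp
  have backward: "\<forall>t\<in>vcarrier (M \<otimes>\<^sub>V M). braiding H M M (braiding H M M t) = t"
    if "triangular H R" "left_induced H R (lcoact M)" "triangular H S" "right_induced H S (rcoact M)" for R S
    using symmetry_of_triangular[OF that] by simp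
  have unit: "left_induced H R (lcoact M) \<Longrightarrow> lcoact M (1 \<otimes>\<^bsub>H,H\<^esub> 1)
      = sweedler H H R (\<lambda>R1 R2. R2 \<otimes>\<^bsub>H,HH\<^esub> (R1 \<otimes>\<^bsub>H,H\<^esub> 1))"
    "right_induced H R (rcoact M) \<Longrightarrow> rcoact M (1 \<otimes>\<^bsub>H,H\<^esub> 1)
      = sweedler H H R (\<lambda>R1 R2. (1 \<otimes>\<^bsub>H,H\<^esub> R1) \<otimes>\<^bsub>HH,H\<^esub> R2)" for R
    by (simp_all add: left_induced_def right_induced_def)
  show ?thesis
    unfolding Let_def using forward backward unit by metis
qed

end
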